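(* Let $\mathcal{H}$ be a $d$-uniform hypergraph and $k$ an integer with $1\le k\le\nu(\mathcal{H})$. Then $$\mathrm{reg}\left(I(\mathcal{H})^{[k]}\right)\ge (d-1)\,\mathrm{aim}(\mathcal{H},k)+k.$$ Specifically, for a simple graph $G$ and any $1\le k\le\nu(G)$, $$\mathrm{reg}\left(I(G)^{[k]}\right)\ge \mathrm{aim}(G,k)+k.$$
   Context: A (simple) hypergraph $\mathcal{H}$ is a pair $(V(\mathcal{H}),E(\mathcal{H}))$ where $V(\mathcal{H})$ is a finite set and $E(\mathcal{H})$ is a collection of nonempty subsets of $V(\mathcal{H})$ (edges), none of which contains another. It is $d$-uniform if every edge has exactly $d$ elements; a simple graph is a $2$-uniform hypergraph. For $W\subseteq V(\mathcal{H})$, the induced sub-hypergraph $\mathcal{H}[W]$ has vertex set $W$ and edge set $\{\mathcal{E}\in E(\mathcal{H}) : \mathcal{E}\subseteq W\}$. A matching of $\mathcal{H}$ is a set $M$ of pairwise disjoint edges; $V(M)$ is the union of the edges in $M$; $\nu(\mathcal{H})$ is the maximum size of a matching. Identify $V(\mathcal{H})=\{x_1,\dots,x_n\}$ with the variables of $R=\mathbb{K}[x_1,\dots,x_n]$, $\mathbb{K}$ a field. The edge ideal is $I(\mathcal{H})=\langle \prod_{x\in\mathcal{E}}x : \mathcal{E}\in E(\mathcal{H})\rangle$. For $k\ge1$, the $k$-th square-free power $I(\mathcal{H})^{[k]}$ is the ideal generated by the square-free monomials in $I(\mathcal{H})^k$; equivalently, it is generated by the products of the monomials corresponding to the edges of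 a matching of size $k$. For a graded ideal $I$, $\mathrm{reg}(I)=\max\{j-i : \beta_{i,j}(I)\ne0\}$, where $\beta_{i,j}(I)$ are the graded Betti numbers of $I$; $\mathrm{reg}(0)=0$. For a $d$-uniform hypergraph $\mathcal{H}$ and $1\le k\le\nu(\mathcal{H})$, a matching $M$ of $\mathcal{H}$ is a $k$-admissible matching if there is a partition $M=M_1\sqcup\cdots\sqcup M_r$ into nonempty parts such that: (1) every edge of $\mathcal{H}[V(M)]$ is an edge of $\mathcal{H}[V(M_i)]$ for some $i\in\{1,\dots,r\}$; (2) $|M|\le r+k-1$. The $k$-admissible matching number is $\mathrm{aim}(\mathcal{H},k)=\max\{|M| : M \text{ is a } k\text{-admissible matching of }\mathcal{H}\}$. *)

theory Defs
  imports
    "HOL-Library.Poly_Mapping"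
    "HOL-Library.Disjoint_Sets"
    "HOL-Algebra.Ideal_Product"
begin

type_synonym 'v hgraph = "'v set \<times> 'v set set"

definition verts :: "'v hgraph \<Rightarrow> 'v set" where
  "verts H = fst H"

definition edges :: "'v hgraph \<Rightarrow> 'v set set" where
  "edges H = snd H"

definition hypergraph :: "'v hgraph \<Rightarrow> bool" where
  "hypergraph H \<longleftrightarrow> finite (verts H) \<and>
     (\<forall>e\<in>edges H. e \<noteq> {} \<and> e \<subseteq> verts H) \<and>
     (\<forall>e\<in>edges H. \<forall>f\<in>edges H. e \<subseteq> f \<longrightarrow> e = f)"

definition uniform_hypergraph :: "nat \<Rightarrow> 'v hgraph \<Rightarrow> bool" where
  "uniform_hypergraph d H \<longleftrightarrow> hypergraph H \<and> (\<forall>e\<in>edges H. card e = d)"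

definition simple_graph :: "'v hgraph \<Rightarrow> bool" where
  "simple_graph G \<longleftrightarrow> uniform_hypergraph 2 G"

definition induced :: "'v hgraph \<Rightarrow> 'v set \<Rightarrow> 'v hgraph" where
  "induced H W = (W, {e \<in> edges H. e \<subseteq> W})"

definition matching :: "'v hgraph \<Rightarrow> 'v set set \<Rightarrow> bool" where
  "matching H M \<longleftrightarrow> M \<subseteq> edges H \<and> pairwise disjnt M"

definition matching_number :: "'v hgraph \<Rightarrow> nat" where
  "matching_number H = Max {card M | M. matching H M}"

definition admissible_matching :: "'v hgraph \<Rightarrow> nat \<Rightarrow> 'v set set \<Rightarrow> bool" where
  "admissible_matching H k M \<longleftrightarrow> matching H M \<and>
     (\<exists>P. partition_on M P \<and>
        (\<forall>e\<in>edges (induced H (\<Union>M)). \<exists>N\<in>P. e \<in> edges (induced H (\<Union>N))) \<and>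
        int (card M) \<le> int (card P) + int k - 1)"

definition aim :: "'v hgraph \<Rightarrow> nat \<Rightarrow> nat" where
  "aim H k = Max {card M | M. admissible_matching H k M}"

text \<open>An exponent vector is a finitely supported function \<^typ>\<open>'v \<Rightarrow>\<^sub>0 nat\<close>; a polynomial maps
  finitely many exponent vectors to nonzero coefficients.  The variables of the ring under
  consideration are only those indexed by the given set \<open>V\<close>, not by the whole type.\<close>

type_synonym ('v, 'k) mpoly = "('v \<Rightarrow>\<^sub>0 nat) \<Rightarrow>\<^sub>0 'k"

definition polys :: "'v set \<Rightarrow> ('v, 'k::field) mpoly set" where
  "polys V = {p. \<forall>t\<in>Poly_Mapping.keys p. Poly_Mapping.keys t \<subseteq> V}"

definition poly_ring :: "'v set \<Rightarrow> ('v, 'k::field) mpoly ring" where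
  "poly_ring V = \<lparr>carrier = polys V, mult = (*), one = 1, zero = 0, add = (+)\<rparr>"

definition var :: "'v \<Rightarrow> ('v, 'k::field) mpoly" where
  "var x = Poly_Mapping.single (Poly_Mapping.single x 1) 1"

definition sqfree_monom :: "'v set \<Rightarrow> ('v, 'k::field) mpoly" where
  "sqfree_monom W = (\<Prod>x\<in>W. var x)"

definition edge_ideal :: "'v hgraph \<Rightarrow> ('v, 'k::field) mpoly set" where
  "edge_ideal H = genideal (poly_ring (verts H)) (sqfree_monom ` edges H)"

definition ideal_power :: "'v set \<Rightarrow> ('v, 'k::field) mpoly set \<Rightarrow> nat \<Rightarrow> ('v, 'k) mpoly set" where
  "ideal_power V I k = (ideal_prod (poly_ring V) I ^^ k) (polys V)"

definition sqfree_power :: "'v set \<Rightarrow> ('v, 'k::field) mpoly set \<Rightarrow> nat \<Rightarrow> ('v, 'k) mpoly set" where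
  "sqfree_power V I k =
     genideal (poly_ring V) (sqfree_monom ` Pow V \<inter> ideal_power V I k)"

definition exp_degree :: "('v \<Rightarrow>\<^sub>0 nat) \<Rightarrow> nat" where
  "exp_degree t = (\<Sum>x\<in>Poly_Mapping.keys t. Poly_Mapping.lookup t x)"

text \<open>Data of an augmented complex \<open>\<dots> \<rightarrow> F\<^sub>2 \<rightarrow> F\<^sub>1 \<rightarrow> F\<^sub>0 \<rightarrow> R\<close> of graded free modules of finite rank
  over the polynomial ring \<open>R\<close>.  \<open>F\<^sub>i\<close> is the direct sum of the \<open>R(-twist i l)\<close> for \<open>l < frank i\<close>;
  its elements are coordinate functions vanishing from \<open>frank i\<close> on.  The \<open>l\<close>-th basis element of
  \<open>F\<^sub>0\<close> is mapped to \<open>aug l\<close>, that of \<open>F\<^sub>i\<^sub>+\<^sub>1\<close> to the element \<open>bdry i l\<close> of \<open>F\<^sub>i\<close>.\<close>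

record (overloaded) ('v, 'k) free_complex =
  frank :: "nat \<Rightarrow> nat"
  twist :: "nat \<Rightarrow> nat \<Rightarrow> nat"
  aug :: "nat \<Rightarrow> ('v, 'k) mpoly"
  bdry :: "nat \<Rightarrow> nat \<Rightarrow> nat \<Rightarrow> ('v, 'k) mpoly"

definition free_module :: "'v set \<Rightarrow> nat \<Rightarrow> (nat \<Rightarrow> ('v, 'k::field) mpoly) set" where
  "free_module V n = {c. (\<forall>l. c l \<in> polys V) \<and> (\<forall>l\<ge>n. c l = 0)}"

definition aug_map :: "('v, 'k::field) free_complex \<Rightarrow> (nat \<Rightarrow> ('v, 'k) mpoly) \<Rightarrow> ('v, 'k) mpoly" where
  "aug_map F c = (\<Sum>l<frank F 0. c l * aug F l)"

definition bdry_map :: "('v, 'k::field) free_complex \<Rightarrow> nat \<Rightarrow> (nat \<Rightarrow> ('v, 'k) mpoly) \<Rightarrow> nat \<Rightarrow> ('v, 'k) mpoly" where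
  "bdry_map F i c = (\<lambda>m. \<Sum>l<frank F (Suc i). c l * bdry F i l m)"

text \<open>The degree conditions say that all maps are homogeneous of degree 0; being stated additively
  they force the \<open>m\<close>-th coordinate of \<open>bdry i l\<close> to be 0 if \<open>twist (i + 1) l < twist i m\<close>.\<close>

definition graded_free_resolution ::
    "'v set \<Rightarrow> ('v, 'k::field) mpoly set \<Rightarrow> ('v, 'k) free_complex \<Rightarrow> bool" where
  "graded_free_resolution V I F \<longleftrightarrow>
     (\<forall>l<frank F 0. aug F l \<in> polys V \<and>
        (\<forall>t\<in>Poly_Mapping.keys (aug F l). exp_degree t = twist F 0 l)) \<and>
     (\<forall>i. \<forall>l<frank F (Suc i). bdry F i l \<in> free_module V (frank F i) \<and>
        (\<forall>m<frank F i. \<forall>t\<in>Poly_Mapping.keys (bdry F i l m).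
           exp_degree t + twist F i m = twist F (Suc i) l)) \<and>
     aug_map F ` free_module V (frank F 0) = I \<and>
     bdry_map F 0 ` free_module V (frank F 1) =
       {c \<in> free_module V (frank F 0). aug_map F c = 0} \<and>
     (\<forall>i. bdry_map F (Suc i) ` free_module V (frank F (Suc (Suc i))) =
       {c \<in> free_module V (frank F (Suc i)). bdry_map F i c = (\<lambda>_. 0)})"

text \<open>Minimality: the image of \<open>F\<^sub>i\<^sub>+\<^sub>1\<close> lies in the product of \<open>F\<^sub>i\<close> with the ideal generated by the
  variables, i.e. the coordinates of the images of the basis have no constant term.\<close>

definition minimal_graded_free_resolution ::
    "'v set \<Rightarrow> ('v, 'k::field) mpoly set \<Rightarrow> ('v, 'k) free_complex \<Rightarrow> bool" where
  "minimal_graded_free_resolution V I F \<longleftrightarrow> graded_free_resolution V I F \<and>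
     (\<forall>i. \<forall>l<frank F (Suc i). \<forall>m<frank F i. Poly_Mapping.lookup (bdry F i l m) 0 = 0)"

text \<open>For finite \<open>V\<close> a graded ideal has a minimal graded free resolution, unique up to
  isomorphism, so the choice is immaterial.\<close>

definition betti :: "'v set \<Rightarrow> ('v, 'k::field) mpoly set \<Rightarrow> nat \<Rightarrow> nat \<Rightarrow> nat" where
  "betti V I i j =
     (let F = (SOME F. minimal_graded_free_resolution V I F)
      in card {l. l < frank F i \<and> twist F i l = j})"

definition reg :: "'v set \<Rightarrow> ('v, 'k::field) mpoly set \<Rightarrow> int" where
  "reg V I = (if I = {0} then 0 else Max {int j - int i | i j. betti V I i j \<noteq> 0})"

end

theory Submission
  imports Defs "HOL-Library.Function_Algebras" "HOL.Vector_Spaces"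
begin

text \<open>Write \<open>J = I(H)\<^sup>[\<^sup>k\<^sup>]\<close> and \<open>K\<close> for the Koszul complex of the variables.  The homology of \<open>K \<otimes> J\<close> in
  homological degree \<open>i\<close> and degree \<open>j\<close> vanishes exactly if \<open>\<beta>\<^sub>i\<^sub>j(J) = 0\<close>: for a resolution
  \<open>\<dots> \<rightarrow> F\<^sub>1 \<rightarrow> F\<^sub>0 \<rightarrow> J\<close> one shifts dimensions along the syzygy modules, since \<open>K \<otimes> F\<^sub>i\<close> is exact in
  positive degrees.  As \<open>J\<close> is a square-free monomial ideal, the homology vanishes in degrees above the
  number of variables.  This bounds the degrees of the generators of all syzygy modules, so that a
  minimal resolution by modules of finite rank exists and the maximum defining the regularity is
  over a finite set.

  For an admissible matching \<open>M\<close> with \<open>r\<close> blocks let \<open>W = V(M)\<close> and \<open>p = card M - k < r\<close>.  In multidegree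
  \<open>W\<close> the complex \<open>K \<otimes> J\<close> is the simplicial chain complex of the sets \<open>S \<subseteq> W\<close> whose complement contains
  a matching of size \<open>k\<close>.  Every \<open>p\<close>-element set is a face, but a face never meets more than \<open>p\<close>
  blocks.  Hence the boundary of a set of \<open>p + 1\<close> vertices from distinct blocks is a cycle that
  maps, under the map to the simplex on the blocks, to a cycle that bounds nothing.  So the Betti number
  for \<open>i = p\<close> and \<open>j = card W = d * card M\<close> is nonzero, and \<open>j - i\<close> is the asserted bound.\<close>

section \<open>Polynomials and exponent vectors\<close>

text \<open>\<open>betti\<close> reads its numbers off one resolution picked by \<open>SOME\<close>,
  and \<open>reg\<close> is a \<open>Max\<close>. A lower bound therefore requires that a minimal
  resolution exists and that the set of values is finite, before any combinatorics. Both rest on one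
  criterion valid for every minimal resolution, in which Koszul homology is only ever zero or
  nonzero. Finite generation of the syzygies has the same source: where homology in homological
  degree 0 vanishes, a homogeneous element is a combination of variables times elements of lower
  degree. The admissibility conditions enter at two points. Condition (2) reads p + 1 <= r, so there
  are enough blocks to choose p + 1 vertices from. Condition (1) puts every edge inside W into one
  block, so that a matching can be bounded block by block; uniformity turns the count of vertices
  into a count of edges. The final number is d * card M - (card M - k). The field is arbitrary and 2
  may be 0 in it, so sums are shown to vanish by cancelling terms in pairs.\<close>

abbreviation coef :: "('a \<Rightarrow>\<^sub>0 'b::zero) \<Rightarrow> 'a \<Rightarrow> 'b" where
  "coef \<equiv> Poly_Mapping.lookup"

abbreviation supp :: "('a \<Rightarrow>\<^sub>0 'b::zero) \<Rightarrow> 'a set" where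
  "supp \<equiv> Poly_Mapping.keys"

abbreviation monom :: "'a \<Rightarrow> 'b \<Rightarrow> 'a \<Rightarrow>\<^sub>0 'b::zero" where
  "monom \<equiv> Poly_Mapping.single"

text \<open>Besides the exponent of a square-free monomial, this is the multidegree of the Koszul
  basis element e_S; a term with exponent t at e_S has multidegree
  \<open>t + sqexp S\<close>.\<close>

definition sqexp :: "'v set \<Rightarrow> 'v \<Rightarrow>\<^sub>0 nat" where
  "sqexp S = (\<Sum>x\<in>S. monom x 1)"

lemma coef_sqexp:
  assumes "finite S"
  shows "coef (sqexp S) x = (if x \<in> S then 1 else 0)"
  using assms by (simp add: sqexp_def lookup_sum lookup_single when_def)

lemma supp_sqexp: "finite S \<Longrightarrow> supp (sqexp S) = S"
  by (auto simp: in_keys_iff coef_sqexp split: if_splits)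

lemma sqexp_insert:
  "finite S \<Longrightarrow> x \<notin> S \<Longrightarrow> sqexp (insert x S) = monom x 1 + sqexp S"
  by (simp add: sqexp_def)

lemma sqexp_remove:
  "finite S \<Longrightarrow> x \<in> S \<Longrightarrow> sqexp S = monom x 1 + sqexp (S - {x})"
  by (metis finite_Diff insert_Diff_single insert_absorb sqexp_insert Diff_iff singletonI)

lemma exp_degree_superset:
  "finite A \<Longrightarrow> supp t \<subseteq> A \<Longrightarrow> exp_degree t = (\<Sum>x\<in>A. coef t x)"
  unfolding exp_degree_def by (rule sum.mono_neutral_left) (auto simp: in_keys_iff)

lemma supp_add_nat: "supp (s + t :: 'v \<Rightarrow>\<^sub>0 nat) = supp s \<union> supp t"
  by (auto simp: in_keys_iff lookup_add)

lemma exp_degree_add: "exp_degree (s + t) = exp_degree s + exp_degree t"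
proof -
  let ?A = "supp s \<union> supp t"
  have "exp_degree u = (\<Sum>x\<in>?A. coef u x)" if "supp u \<subseteq> ?A" for u
    using that by (intro exp_degree_superset) auto
  then show ?thesis
    by (simp add: supp_add_nat lookup_add sum.distrib)
qed

lemma exp_degree_monom [simp]: "exp_degree (monom x 1) = 1"
  by (simp add: exp_degree_def)

lemma exp_degree_0_iff: "exp_degree t = 0 \<longleftrightarrow> t = 0"
  by (auto simp: exp_degree_def in_keys_iff poly_mapping_eq_iff fun_eq_iff)

lemma exp_degree_sqexp: "finite S \<Longrightarrow> exp_degree (sqexp S) = card S"
  by (simp add: exp_degree_def supp_sqexp coef_sqexp)

lemma monom_minus_add: "1 \<le> coef t x \<Longrightarrow> (t - monom x 1) + monom x (1::nat) = t"
  by (rule poly_mapping_eqI) (auto simp: lookup_add lookup_minus lookup_single when_def)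

lemma coef_monom_mult_add:
  fixes p :: "('v, 'k::field) mpoly"
  shows "coef (monom s c * p) (s + u) = c * coef p u"
  by (simp add: lookup_mult lookup_single when_mult)

lemma coef_monom_mult_other:
  fixes p :: "('v, 'k::field) mpoly"
  assumes "\<And>u. t \<noteq> s + u"
  shows "coef (monom s c * p) t = 0"
  using assms by (simp add: lookup_mult lookup_single when_mult)

lemma coef_var_mult:
  "coef (var x * p) t = (if 1 \<le> coef t x then coef p (t - monom x 1) else 0)"
proof (cases "1 \<le> coef t x")
  case True
  then have "coef (var x * p) t = coef (monom (monom x 1) 1 * p) (monom x 1 + (t - monom x 1))"
    by (metis True add.commute monom_minus_add var_def)
  also have "\<dots> = coef p (t - monom x 1)"
    by (simp only: coef_monom_mult_add) simp
  finally show ?thesis using True by simp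
next
  case False
  then have "t \<noteq> monom x 1 + u" for u
    by (auto simp: lookup_add)
  with False show ?thesis
    by (simp add: var_def coef_monom_mult_other)
qed

lemma coef_const_mult: "coef (monom 0 c * p) t = c * coef (p :: ('v, 'k::field) mpoly) t"
  using coef_monom_mult_add[of 0 c p t] by simp

lemma coef_const_mult_0:
  assumes "\<And>t. t \<in> supp p \<Longrightarrow> t = 0" shows "(p :: ('v, 'k::field) mpoly) = monom 0 (coef p 0)"
  using assms by (intro poly_mapping_eqI) (auto simp: lookup_single when_def in_keys_iff)

lemma supp_empty_iff: "supp p = {} \<longleftrightarrow> p = 0"
  by (metis keys_zero not_in_keys_iff_lookup_eq_zero empty_iff lookup_zero poly_mapping_eqI)

lemma supp_uminus: "supp (- p :: ('a \<Rightarrow>\<^sub>0 'b::ab_group_add)) = supp p"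
  by (auto simp: in_keys_iff)

lemma supp_diff: "supp (p - q :: ('a \<Rightarrow>\<^sub>0 'b::ab_group_add)) \<subseteq> supp p \<union> supp q"
  by (auto simp: in_keys_iff lookup_minus)

lemma supp_sum: "supp (\<Sum>i\<in>A. p i :: ('a \<Rightarrow>\<^sub>0 'b::comm_monoid_add)) \<subseteq> (\<Union>i\<in>A. supp (p i))"
  by (auto simp: in_keys_iff lookup_sum dest!: sum.not_neutral_contains_not_neutral)

lemma mpoly_eq_sum_monom: "(p :: ('v, 'k::field) mpoly) = (\<Sum>t\<in>supp p. monom t (coef p t))"
proof (rule poly_mapping_eqI)
  fix u
  have "coef (\<Sum>t\<in>supp p. monom t (coef p t)) u = (\<Sum>t\<in>supp p. if t = u then coef p t else 0)"
    by (simp add: lookup_sum lookup_single when_def)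
  also have "\<dots> = coef p u"
    by (subst sum.delta) (auto simp: in_keys_iff)
  finally show "coef p u = coef (\<Sum>t\<in>supp p. monom t (coef p t)) u" by simp
qed

lemma polys_0 [simp]: "0 \<in> polys V"
  and polys_1 [simp]: "1 \<in> polys V"
  and polys_add [simp]: "p \<in> polys V \<Longrightarrow> q \<in> polys V \<Longrightarrow> p + q \<in> polys V"
  and polys_uminus [simp]: "p \<in> polys V \<Longrightarrow> - p \<in> polys V"
  and polys_const [simp]: "monom 0 c \<in> polys V"
  and polys_var [simp]: "x \<in> V \<Longrightarrow> var x \<in> polys V"
  using keys_add[of p q] by (auto simp: polys_def supp_uminus var_def)

lemma polys_mult [simp]:
  assumes "p \<in> polys V" "q \<in> polys V" shows "p * q \<in> polys V"
  using assms keys_mult[of p q] by (fastforce simp: polys_def supp_add_nat)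

lemma sqfree_monom_eq: "finite W \<Longrightarrow> sqfree_monom W = monom (sqexp W) 1"
  by (induction W rule: finite_induct)
    (auto simp: sqfree_monom_def sqexp_def var_def mult_single)

lemma polys_sqfree_monom: "finite W \<Longrightarrow> W \<subseteq> V \<Longrightarrow> sqfree_monom W \<in> polys V"
  by (auto simp: sqfree_monom_eq polys_def supp_sqexp)

definition pfilter :: "('a \<Rightarrow> bool) \<Rightarrow> ('a \<Rightarrow>\<^sub>0 'b::zero) \<Rightarrow> 'a \<Rightarrow>\<^sub>0 'b" where
  "pfilter P p = Poly_Mapping.mapp (\<lambda>t c. if P t then c else 0) p"

lemma coef_pfilter: "coef (pfilter P p) t = (if P t then coef p t else 0)"
  by (auto simp: pfilter_def lookup_mapp when_def in_keys_iff)

lemma supp_pfilter: "supp (pfilter P p) = {t \<in> supp p. P t}"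
  by (auto simp: in_keys_iff coef_pfilter split: if_splits)

lemma pfilter_id: "(\<And>t. t \<in> supp p \<Longrightarrow> P t) \<Longrightarrow> pfilter P p = p"
  by (rule poly_mapping_eqI) (auto simp: coef_pfilter in_keys_iff)

lemma pfilter_empty: "(\<And>t. t \<in> supp p \<Longrightarrow> \<not> P t) \<Longrightarrow> pfilter P p = 0"
  by (rule poly_mapping_eqI) (auto simp: coef_pfilter in_keys_iff)

lemma pfilter_0 [simp]: "pfilter P 0 = 0"
  by (rule pfilter_id) simp

lemma pfilter_add: "pfilter P (p + q) = pfilter P p + pfilter P (q :: 'a \<Rightarrow>\<^sub>0 'b::comm_monoid_add)"
  by (rule poly_mapping_eqI) (auto simp: coef_pfilter lookup_add)

lemma pfilter_sum:
  "pfilter P (sum p A) = (\<Sum>i\<in>A. pfilter P (p i :: 'a \<Rightarrow>\<^sub>0 'b::comm_monoid_add))"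
  by (rule poly_mapping_eqI) (auto simp: coef_pfilter lookup_sum)

text \<open>Split \<open>p\<close> into the terms with and without \<open>P'\<close>: multiplication
  by a term of \<open>q\<close> sends the former into \<open>P\<close> and the latter outside it.
  With degree conditions for \<open>P\<close> and \<open>P'\<close> this is how homogeneous
  components pass through products.\<close>

lemma pfilter_mult:
  fixes p q :: "('v, 'k::field) mpoly"
  assumes "\<And>s t. s \<in> supp q \<Longrightarrow> P (t + s) \<longleftrightarrow> P' t"
  shows "pfilter P (p * q) = pfilter P' p * q"
proof -
  let ?p1 = "pfilter P' p" and ?p2 = "pfilter (\<lambda>t. \<not> P' t) p"
  have p: "p = ?p1 + ?p2"
    by (rule poly_mapping_eqI) (auto simp: coef_pfilter lookup_add)
  have 1: "pfilter P (?p1 * q) = ?p1 * q"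
    using keys_mult[of ?p1 q] assms by (intro pfilter_id) (fastforce simp: supp_pfilter)
  have 2: "pfilter P (?p2 * q) = 0"
    using keys_mult[of ?p2 q] assms by (intro pfilter_empty) (fastforce simp: supp_pfilter)
  have "pfilter P (p * q) = pfilter P (?p1 * q + ?p2 * q)"
    by (metis p distrib_right)
  then show ?thesis
    by (simp add: pfilter_add 1 2)
qed

lemma polys_pfilter: "p \<in> polys V \<Longrightarrow> pfilter P p \<in> polys V"
  by (auto simp: polys_def supp_pfilter)

section \<open>Boundaries and cones\<close>

text \<open>The vertices carry no order of their own, so a labelling \<open>f\<close> supplies it.
  It stays a parameter because the combinatorial part needs an order adapted to the blocks. The
  value lies in an arbitrary commutative ring, to be usable on polynomials and on their coefficients
  alike.\<close>

definition ksgn :: "('v \<Rightarrow> nat) \<Rightarrow> 'v \<Rightarrow> 'v set \<Rightarrow> 'a::comm_ring_1" where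
  "ksgn f x S = (- 1) ^ card {y \<in> S. f y < f x}"

lemma ksgn_square [simp]: "ksgn f x S * ksgn f x S = 1"
  by (simp add: ksgn_def flip: power_add mult_2)

lemma ksgn_square_left [simp]: "ksgn f x S * (ksgn f x S * a) = a"
  by (simp flip: mult.assoc)

lemma ksgn_insert:
  assumes "finite S" "y \<notin> S"
  shows "ksgn f x (insert y S) = (if f y < f x then - ksgn f x S else ksgn f x S)"
proof -
  have "{z \<in> insert y S. f z < f x} =
      (if f y < f x then insert y {z \<in> S. f z < f x} else {z \<in> S. f z < f x})"
    by auto
  with assms show ?thesis by (simp add: ksgn_def)
qed

text \<open>Of x and y exactly one precedes the other, so exactly one of the two signs at the
  enlarged sets flips.\<close>

lemma ksgn_swap:
  assumes "finite S" "x \<notin> S" "y \<notin> S" "f x \<noteq> f y"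
  shows "ksgn f x S * ksgn f y (insert x S) = - (ksgn f y S * ksgn f x (insert y S))"
  using assms by (cases "f x < f y") (auto simp: ksgn_insert)

lemma coef_ksgn_mult:
  "coef (ksgn f x S * p) t = ksgn f x S * coef (p :: ('v, 'k::field) mpoly) t"
  by (cases "even (card {y \<in> S. f y < f x})") (simp_all add: ksgn_def)

lemma ksgn_cases: "ksgn f x S = (1 :: 'a::comm_ring_1) \<or> ksgn f x S = (- 1 :: 'a)"
  by (cases "even (card {y \<in> S. f y < f x})") (simp_all add: ksgn_def)

lemma supp_ksgn_mult [simp]: "supp (ksgn f x S * p) = supp (p :: ('v, 'k::field) mpoly)"
  using ksgn_cases[of f x S, where ?'a = "('v, 'k) mpoly"] by (auto simp: supp_uminus)

lemma polys_ksgn [simp]: "(ksgn f x S :: ('v, 'k::field) mpoly) \<in> polys V"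
  using ksgn_cases[of f x S, where ?'a = "('v, 'k) mpoly"] by auto

text \<open>Exchanging the two summations would only show that twice the sum is 0, which says
  nothing in characteristic 2; hence the induction, in which the terms with z as first and as second
  index cancel.\<close>

lemma sum_antisym:
  fixes a :: "'b \<Rightarrow> 'b \<Rightarrow> 'a::ab_group_add"
  assumes "finite A" "\<And>x y. x \<in> A \<Longrightarrow> y \<in> A \<Longrightarrow> x \<noteq> y \<Longrightarrow> a x y = - a y x"
  shows "(\<Sum>x\<in>A. \<Sum>y\<in>A - {x}. a x y) = 0"
  using assms
proof (induction A rule: finite_induct)
  case (insert z A)
  have 1: "(\<Sum>y\<in>insert z A - {x}. a x y) = a x z + (\<Sum>y\<in>A - {x}. a x y)" if "x \<in> A" for x
  proof -
    have "insert z A - {x} = insert z (A - {x})" using insert.hyps that by auto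
    then show ?thesis using insert.hyps by simp
  qed
  have IH: "(\<Sum>x\<in>A. \<Sum>y\<in>A - {x}. a x y) = 0"
    by (intro insert.IH insert.prems) blast+
  have 2: "insert z A - {z} = A"
    using insert.hyps by auto
  have "(\<Sum>x\<in>insert z A. \<Sum>y\<in>insert z A - {x}. a x y)
      = (\<Sum>y\<in>A. a z y) + (\<Sum>x\<in>A. \<Sum>y\<in>insert z A - {x}. a x y)"
    by (simp only: sum.insert[OF insert.hyps] 2)
  also have "(\<Sum>x\<in>A. \<Sum>y\<in>insert z A - {x}. a x y) = (\<Sum>x\<in>A. a x z + (\<Sum>y\<in>A - {x}. a x y))"
    by (intro sum.cong refl 1)
  also have "\<dots> = (\<Sum>x\<in>A. a x z)"
    by (simp add: sum.distrib IH)
  also have "\<dots> = (\<Sum>y\<in>A. - a z y)"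
    using insert.hyps by (intro sum.cong refl insert.prems) blast+
  also have "(\<Sum>y\<in>A. a z y) + \<dots> = 0"
    by (simp add: sum_negf)
  finally show ?case .
qed simp

locale koszul =
  fixes V :: "'v set" and f :: "'v \<Rightarrow> nat"
  assumes finite_V: "finite V" and inj_f: "inj_on f V"
begin

text \<open>The coefficient of e_S in the boundary of the chain \<Sum> w(T) e_T: it collects what
  every face \<open>insert x S\<close> contributes to its facet S.\<close>

definition kd1 :: "('v set \<Rightarrow> ('v, 'k::field) mpoly) \<Rightarrow> 'v set \<Rightarrow> ('v, 'k) mpoly" where
  "kd1 w S = (\<Sum>x\<in>V - S. ksgn f x S * (var x * w (insert x S)))"

lemma coef_kd1:
  "coef (kd1 w S) t =
    (\<Sum>x\<in>V - S. ksgn f x S * (if 1 \<le> coef t x then coef (w (insert x S)) (t - monom x 1) else 0))"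
  by (simp only: kd1_def lookup_sum coef_ksgn_mult coef_var_mult)

lemma kd1_kd1:
  fixes w :: "'v set \<Rightarrow> ('v, 'k::field) mpoly"
  assumes "S \<subseteq> V"
  shows "kd1 (kd1 w) S = 0"
proof -
  have fin: "finite S" using assms finite_V finite_subset by blast
  define a where "a x y = ksgn f x S * (ksgn f y (insert x S) *
    (var x * (var y * w (insert y (insert x S)))))" for x y
  have "kd1 (kd1 w) S = (\<Sum>x\<in>V - S. \<Sum>y\<in>V - insert x S. a x y)"
    unfolding kd1_def a_def sum_distrib_left
    by (intro sum.cong refl) (simp add: algebra_simps)
  also have "\<dots> = (\<Sum>x\<in>V - S. \<Sum>y\<in>V - S - {x}. a x y)"
    by (intro sum.cong refl) auto
  also have "\<dots> = 0"
  proof (rule sum_antisym)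
    fix x y assume "x \<in> V - S" "y \<in> V - S" "x \<noteq> y"
    then have "f x \<noteq> f y" using inj_f by (auto dest: inj_onD)
    then have sw: "(ksgn f x S * ksgn f y (insert x S) :: ('v, 'k) mpoly)
        = - (ksgn f y S * ksgn f x (insert y S))"
      using fin \<open>x \<in> V - S\<close> \<open>y \<in> V - S\<close> by (intro ksgn_swap) auto
    have "a x y = (ksgn f x S * ksgn f y (insert x S)) * (var x * (var y * w (insert y (insert x S))))"
      by (simp add: a_def mult.assoc)
    also have "\<dots> = - a y x"
      unfolding sw by (simp add: a_def insert_commute ac_simps)
    finally show "a x y = - a y x" .
  qed (use finite_V in auto)
  finally show ?thesis .
qed

text \<open>In each multidegree \<open>a\<close> the complex is the simplicial chain complex of a simplicial complex.
  If that is a cone with apex \<open>\<xi> a\<close>, then adding the apex to a face is a contracting homotopy.\<close>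

lemma cone:
  fixes w :: "'v set \<Rightarrow> ('v, 'k::field) mpoly"
  assumes supp_w: "\<And>S. w S \<noteq> 0 \<Longrightarrow> S \<subseteq> V"
    and polys_w: "\<And>S. w S \<in> polys V"
    and cycle: "\<And>S. kd1 w S = 0"
    and apex: "\<And>S t. t \<in> supp (w S) \<Longrightarrow> \<xi> (t + sqexp S) \<in> supp (t + sqexp S)"
  shows "\<exists>h. (\<forall>S. kd1 h S = w S) \<and> (\<forall>S. \<forall>t\<in>supp (h S). S \<subseteq> V \<and>
    (\<exists>x\<in>S. x = \<xi> (t + sqexp S) \<and> t + monom x 1 \<in> supp (w (S - {x}))))"
proof -
  \<comment> \<open>The term of \<open>w\<close> with exponent t + x at e_(S - x) is moved to the
    exponent t at e_S. The multidegree stays the same, so the apex can be recomputed from t and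
    S.\<close>
  define h0 where "h0 S t = (let x = \<xi> (t + sqexp S) in
    if S \<subseteq> V \<and> x \<in> S then ksgn f x (S - {x}) * coef (w (S - {x})) (t + monom x 1) else 0)" for S t
  define h where "h S = Abs_poly_mapping (h0 S)" for S
  have fin: "finite S" if "S \<subseteq> V" for S
    using that finite_V finite_subset by blast
  have fin_h0: "finite {t. h0 S t \<noteq> 0}" for S
  proof (cases "S \<subseteq> V")
    case True
    have "{t. h0 S t \<noteq> 0} \<subseteq> (\<Union>x\<in>S. (\<lambda>u. u - monom x 1) ` supp (w (S - {x})))"
    proof safe
      fix t assume nz: "h0 S t \<noteq> 0"
      define x where "x = \<xi> (t + sqexp S)"
      from nz have "x \<in> S" "t + monom x 1 \<in> supp (w (S - {x}))"
        by (auto simp: h0_def Let_def x_def[symmetric] in_keys_iff split: if_splits)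
      moreover have "t = (t + monom x 1) - monom x 1" by simp
      ultimately show "t \<in> (\<Union>x\<in>S. (\<lambda>u. u - monom x 1) ` supp (w (S - {x})))" by blast
    qed
    moreover have "finite (\<Union>x\<in>S. (\<lambda>u. u - monom x 1) ` supp (w (S - {x})))"
      using fin[OF True] by auto
    ultimately show ?thesis by (rule finite_subset)
  qed (auto simp: h0_def Let_def)
  have coef_h: "coef (h S) t = h0 S t" for S t
    unfolding h_def by (simp add: fin_h0)
  have h_zero: "h S = 0" if "\<not> S \<subseteq> V" for S
    by (rule poly_mapping_eqI) (simp add: coef_h h0_def Let_def that)
  \<comment> \<open>The origin of every term of \<open>h\<close> is recorded so that a caller can
    check that \<open>h\<close> stays in its module and has the right degree.\<close>
  have "S \<subseteq> V \<and> (\<exists>x\<in>S. x = \<xi> (t + sqexp S) \<and> t + monom x 1 \<in> supp (w (S - {x})))"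
    if "t \<in> supp (h S)" for S t
    using that by (auto simp: in_keys_iff coef_h h0_def Let_def split: if_splits)
  moreover have "kd1 h S = w S" for S
  proof (cases "S \<subseteq> V")
    case False
    then have "w S = 0" using supp_w by blast
    moreover have "h (insert x S) = 0" for x using False by (intro h_zero) auto
    ultimately show ?thesis by (simp add: kd1_def)
  next
    case True
    note finS = fin[OF True]
    show ?thesis
    proof (rule poly_mapping_eqI)
      fix t
      define x where "x = \<xi> (t + sqexp S)"
      have multideg: "(t - monom y 1) + sqexp (insert y S) = t + sqexp S"
        if "y \<in> V - S" "1 \<le> coef t y" for y
      proof -
        have "(t - monom y 1) + sqexp (insert y S) = ((t - monom y 1) + monom y 1) + sqexp S"
          using that finS by (simp add: sqexp_insert add.assoc)
        then show ?thesis using that monom_minus_add[of t y] by simp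
      qed
      have coef_h': "coef (h (insert y S)) (t - monom y 1) = (if x \<in> insert y S
          then ksgn f x (insert y S - {x}) * coef (w (insert y S - {x})) (t - monom y 1 + monom x 1) else 0)"
        if "y \<in> V - S" "1 \<le> coef t y" for y
        using that True multideg[OF that] by (simp add: coef_h h0_def x_def Let_def)
      show "coef (kd1 h S) t = coef (w S) t"
      proof (cases "x \<in> S")
        case False
        \<comment> \<open>A face \<open>insert y S\<close> contains the apex only for y = x, and
          there \<open>h\<close> returns the coefficient of \<open>w\<close> at S with the same
          sign.\<close>
        have sm: "coef (kd1 h S) t = (\<Sum>y\<in>V - S. if y = x \<and> 1 \<le> coef t x then coef (w S) t else 0)"
          unfolding coef_kd1
        proof (intro sum.cong refl)
          fix y assume y: "y \<in> V - S"
          show "ksgn f y S * (if 1 \<le> coef t y then coef (h (insert y S)) (t - monom y 1) else 0)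
            = (if y = x \<and> 1 \<le> coef t x then coef (w S) t else 0)"
          proof (cases "1 \<le> coef t y \<and> y = x")
            case True
            then have "t - monom y 1 + monom x 1 = t"
              using monom_minus_add[of t y] by metis
            moreover have "insert y S - {x} = S" using True False by auto
            ultimately show ?thesis using True coef_h'[OF y] by simp
          next
            case nt: False
            then show ?thesis using coef_h'[OF y] False by auto
          qed
        qed
        show ?thesis
        proof (cases "t \<in> supp (w S)")
          case True
          then have "x \<in> supp (t + sqexp S)" unfolding x_def by (rule apex)
          then have xt: "x \<in> supp t" using False finS by (simp add: supp_add_nat supp_sqexp)
          moreover have "x \<in> V" using xt True polys_w[of S] by (auto simp: polys_def)
          ultimately show ?thesis
            using False sm finite_V by (auto simp: sum.If_cases in_keys_iff Suc_le_eq)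
        next
          case nt: False
          then have "coef (w S) t = 0" by (simp add: in_keys_iff)
          then show ?thesis unfolding sm by (simp cong: if_cong)
        qed
      next
        case xS: True
        \<comment> \<open>Here the value comes from the cycle condition at T and the exponent t + x:
          its summand for x is the coefficient of \<open>w\<close> at S, and the others are, up to
          sign, the summands of the boundary of \<open>h\<close> at S.\<close>
        define T where "T = S - {x}"
        have S: "S = insert x T" and xT: "x \<notin> T" and finT: "finite T" and xV: "x \<in> V"
          using xS finS True by (auto simp: T_def)
        define g where "g y = (if 1 \<le> coef t y
          then coef (w (insert y T)) (t - monom y 1 + monom x 1) else 0)" for y
        have VT: "V - T = insert x (V - S)" using xV by (auto simp: T_def)
        have "0 = coef (kd1 w T) (t + monom x 1)" by (simp add: cycle)
        also have "\<dots> = (\<Sum>y\<in>insert x (V - S). ksgn f y T * (if 1 \<le> coef (t + monom x 1) y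
            then coef (w (insert y T)) (t + monom x 1 - monom y 1) else 0))"
          by (simp only: coef_kd1 VT)
        also have "\<dots> = ksgn f x T * coef (w S) t + (\<Sum>y\<in>V - S. ksgn f y T * g y)"
        proof (subst sum.insert)
          show "finite (V - S)" "x \<notin> V - S" using finite_V xS by auto
          have "(\<Sum>y\<in>V - S. ksgn f y T * (if 1 \<le> coef (t + monom x 1) y
              then coef (w (insert y T)) (t + monom x 1 - monom y 1) else 0)) = (\<Sum>y\<in>V - S. ksgn f y T * g y)"
          proof (intro sum.cong refl)
            fix y assume y: "y \<in> V - S"
            then have "y \<noteq> x" using xS by auto
            then have "coef (t + monom x 1) y = coef t y" by (simp add: lookup_add lookup_single)
            moreover have "t + monom x 1 - monom y 1 = t - monom y 1 + monom x 1" if "1 \<le> coef t y"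
              using that by (intro poly_mapping_eqI) (auto simp: lookup_add lookup_minus lookup_single when_def)
            ultimately show "ksgn f y T * (if 1 \<le> coef (t + monom x 1) y
              then coef (w (insert y T)) (t + monom x 1 - monom y 1) else 0) = ksgn f y T * g y"
              by (simp add: g_def)
          qed
          then show "ksgn f x T * (if 1 \<le> coef (t + monom x 1) x
              then coef (w (insert x T)) (t + monom x 1 - monom x 1) else 0) +
            (\<Sum>y\<in>V - S. ksgn f y T * (if 1 \<le> coef (t + monom x 1) y
              then coef (w (insert y T)) (t + monom x 1 - monom y 1) else 0))
            = ksgn f x T * coef (w S) t + (\<Sum>y\<in>V - S. ksgn f y T * g y)"
            by (simp add: lookup_add S)
        qed
        finally have cyc: "0 = ksgn f x T * coef (w S) t + (\<Sum>y\<in>V - S. ksgn f y T * g y)" .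
        have "0 = ksgn f x T * (ksgn f x T * coef (w S) t + (\<Sum>y\<in>V - S. ksgn f y T * g y))"
          using cyc by simp
        also have "\<dots> = coef (w S) t + (\<Sum>y\<in>V - S. ksgn f x T * (ksgn f y T * g y))"
          by (simp add: distrib_left sum_distrib_left)
        finally have val: "coef (w S) t = - (\<Sum>y\<in>V - S. ksgn f x T * (ksgn f y T * g y))"
          by (simp add: eq_neg_iff_add_eq_0)
        have "coef (kd1 h S) t = (\<Sum>y\<in>V - S. - (ksgn f x T * (ksgn f y T * g y)))"
          unfolding coef_kd1
        proof (intro sum.cong refl)
          fix y assume y: "y \<in> V - S"
          then have yx: "y \<noteq> x" "y \<notin> T" using xS by (auto simp: T_def)
          have "f x \<noteq> f y" using yx y xV inj_f by (auto dest: inj_onD)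
          then have fx: "f x < f y \<or> f y < f x" by linarith
          have ins: "insert y S - {x} = insert y T" using yx by (auto simp: T_def)
          have "(if 1 \<le> coef t y then coef (h (insert y S)) (t - monom y 1) else 0)
            = ksgn f x (insert y T) * g y"
            using coef_h'[OF y] xS by (simp add: g_def ins)
          moreover have "(ksgn f y S * ksgn f x (insert y T) :: 'k) = - (ksgn f x T * ksgn f y T)"
            unfolding S using finT xT yx fx by (auto simp: ksgn_insert)
          ultimately show "ksgn f y S * (if 1 \<le> coef t y then coef (h (insert y S)) (t - monom y 1) else 0)
            = - (ksgn f x T * (ksgn f y T * g y))"
            by (simp flip: mult.assoc)
        qed
        then show ?thesis by (simp add: val sum_negf)
      qed
    qed
  qed
  ultimately show ?thesis by blast
qed

end

section \<open>Koszul chains of graded modules and dimension shifting\<close>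

definition homog :: "(nat \<Rightarrow> nat) \<Rightarrow> nat \<Rightarrow> (nat \<Rightarrow> ('v, 'k::field) mpoly) \<Rightarrow> bool" where
  "homog \<tau> e c \<longleftrightarrow> (\<forall>l. \<forall>t\<in>supp (c l). exp_degree t + \<tau> l = e)"

definition hcomp :: "(nat \<Rightarrow> nat) \<Rightarrow> nat \<Rightarrow> (nat \<Rightarrow> ('v, 'k::field) mpoly) \<Rightarrow> nat \<Rightarrow> ('v, 'k) mpoly" where
  "hcomp \<tau> e c = (\<lambda>l. pfilter (\<lambda>t. exp_degree t + \<tau> l = e) (c l))"

text \<open>The linear map that sends the l-th basis element to \<open>b l\<close>. This one form
  serves for the boundary maps and, through \<open>coord0\<close>, for the augmentation.\<close>

definition gmap :: "(nat \<Rightarrow> nat \<Rightarrow> ('v, 'k::field) mpoly) \<Rightarrow> nat \<Rightarrow> (nat \<Rightarrow> ('v, 'k) mpoly) \<Rightarrow> nat \<Rightarrow> ('v, 'k) mpoly" where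
  "gmap b N c = (\<lambda>m. \<Sum>l<N. c l * b l m)"

definition submod :: "'v set \<Rightarrow> (nat \<Rightarrow> ('v, 'k::field) mpoly) set \<Rightarrow> bool" where
  "submod V M \<longleftrightarrow> 0 \<in> M \<and> (\<forall>c\<in>M. \<forall>d\<in>M. c + d \<in> M) \<and> (\<forall>p\<in>polys V. \<forall>c\<in>M. (\<lambda>l. p * c l) \<in> M)"

lemma homog_0 [simp]: "homog \<tau> e 0"
  by (simp add: homog_def)

lemma homog_diff: "homog \<tau> e c \<Longrightarrow> homog \<tau> e d \<Longrightarrow> homog \<tau> e (c - d)"
  using supp_diff by (fastforce simp: homog_def)

lemma homog_hcomp: "homog \<tau> e (hcomp \<tau> e c)"
  by (simp add: homog_def hcomp_def supp_pfilter)

lemma hcomp_id: "homog \<tau> e c \<Longrightarrow> hcomp \<tau> e c = c"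
  by (auto simp: homog_def hcomp_def intro!: ext pfilter_id)

text \<open>The extra shift \<open>s\<close> will be \<open>card S\<close>, the degree of the Koszul
  basis element at which the coefficient sits.\<close>

lemma homog_gmap:
  assumes "homog (\<lambda>l. \<tau>' l + s) e c" "\<And>l. l < N \<Longrightarrow> homog \<tau> (\<tau>' l) (b l)"
  shows "homog (\<lambda>m. \<tau> m + s) e (gmap b N c)"
  unfolding homog_def
proof (intro allI ballI)
  fix m t assume "t \<in> supp (gmap b N c m)"
  then obtain l where l: "l < N" "t \<in> supp (c l * b l m)"
    using supp_sum[of "\<lambda>l. c l * b l m" "{..<N}"] by (auto simp: gmap_def)
  then obtain u v where "t = u + v" "u \<in> supp (c l)" "v \<in> supp (b l m)"
    using keys_mult[of "c l" "b l m"] by auto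
  then show "exp_degree t + (\<tau> m + s) = e"
    using assms l(1) by (fastforce simp: homog_def exp_degree_add)
qed

lemma gmap_hcomp:
  assumes "\<And>l. l < N \<Longrightarrow> homog \<tau> (\<tau>' l) (b l)"
  shows "gmap b N (hcomp (\<lambda>l. \<tau>' l + s) e c) = hcomp (\<lambda>m. \<tau> m + s) e (gmap b N c)"
proof
  fix m
  have "pfilter (\<lambda>t. exp_degree t + (\<tau> m + s) = e) (c l * b l m)
      = pfilter (\<lambda>t. exp_degree t + (\<tau>' l + s) = e) (c l) * b l m" if "l < N" for l
    using assms[OF that] by (intro pfilter_mult) (fastforce simp: homog_def exp_degree_add)
  then show "gmap b N (hcomp (\<lambda>l. \<tau>' l + s) e c) m = hcomp (\<lambda>m. \<tau> m + s) e (gmap b N c) m"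
    by (simp add: gmap_def hcomp_def pfilter_sum)
qed

lemma gmap_0 [simp]: "gmap b N 0 = 0"
  by (simp add: gmap_def fun_eq_iff)

lemma gmap_add: "gmap b N (c + d) = gmap b N c + gmap b N d"
  by (simp add: gmap_def fun_eq_iff distrib_right sum.distrib)

lemma gmap_diff: "gmap b N (c - d) = gmap b N c - gmap b N d"
  by (simp add: gmap_def fun_eq_iff left_diff_distrib sum_subtractf)

lemma gmap_mult: "gmap b N (\<lambda>l. p * c l) = (\<lambda>m. p * gmap b N c m)"
  by (simp add: gmap_def fun_eq_iff sum_distrib_left mult.assoc)

lemma submod_0: "submod V M \<Longrightarrow> 0 \<in> M"
  and submod_add: "submod V M \<Longrightarrow> c \<in> M \<Longrightarrow> d \<in> M \<Longrightarrow> c + d \<in> M"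
  and submod_mult: "submod V M \<Longrightarrow> p \<in> polys V \<Longrightarrow> c \<in> M \<Longrightarrow> (\<lambda>l. p * c l) \<in> M"
  by (auto simp: submod_def)

lemma submod_diff:
  assumes "submod V M" "c \<in> M" "d \<in> M" shows "c - d \<in> M"
proof -
  have "c + (\<lambda>l. (- 1) * d l) \<in> M"
    using assms by (intro submod_add submod_mult) auto
  moreover have "c + (\<lambda>l. (- 1) * d l) = c - d" by (simp add: fun_eq_iff)
  ultimately show ?thesis by simp
qed

lemma submod_sum:
  assumes "submod V M" "\<And>i. i \<in> A \<Longrightarrow> c i \<in> M"
  shows "(\<lambda>l. \<Sum>i\<in>A. c i l) \<in> M"
  using assms(2)
proof (induction A rule: infinite_finite_induct)
  case (insert x A)
  then have "(\<lambda>l. \<Sum>i\<in>insert x A. c i l) = c x + (\<lambda>l. \<Sum>i\<in>A. c i l)"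
    by (simp add: fun_eq_iff)
  with insert assms(1) show ?case by (simp add: submod_add)
qed (use submod_0[OF assms(1)] in \<open>simp_all add: zero_fun_def\<close>)

lemma submod_free: "submod V (free_module V N)"
  by (auto simp: submod_def free_module_def)

lemma submod_gmap_image:
  "submod V (gmap b N ` free_module V N)"
proof -
  note free = submod_free[of V N]
  show ?thesis
    unfolding submod_def
  proof (intro conjI ballI)
    show "0 \<in> gmap b N ` free_module V N"
      using submod_0[OF free] by (intro image_eqI[of _ _ 0]) auto
    fix c d assume "c \<in> gmap b N ` free_module V N" "d \<in> gmap b N ` free_module V N"
    then obtain c' d' where "c = gmap b N c'" "c' \<in> free_module V N" "d = gmap b N d'" "d' \<in> free_module V N"
      by blast
    then show "c + d \<in> gmap b N ` free_module V N"
      using submod_add[OF free] by (intro image_eqI[of _ _ "c' + d'"]) (auto simp: gmap_add)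
  next
    fix p :: "('a, 'b) mpoly" and c assume "p \<in> polys V" "c \<in> gmap b N ` free_module V N"
    then obtain c' where "c = gmap b N c'" "c' \<in> free_module V N" by blast
    then show "(\<lambda>l. p * c l) \<in> gmap b N ` free_module V N"
      using submod_mult[OF free \<open>p \<in> polys V\<close>]
      by (intro image_eqI[of _ _ "\<lambda>l. p * c' l"]) (auto simp: gmap_mult)
  qed
qed

lemma submod_gmap_kernel: "submod V {c \<in> free_module V N. gmap b N c = 0}"
proof -
  have "(\<lambda>m. p * gmap b N c m) = 0" if "gmap b N c = 0" for p c
    using that by (simp add: fun_eq_iff)
  then show ?thesis
    using submod_free[of V N] unfolding submod_def by (auto simp: gmap_add gmap_mult simp flip: zero_fun_def)
qed

lemma hcomp_free: "c \<in> free_module V N \<Longrightarrow> hcomp \<tau> e c \<in> free_module V N"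
  by (auto simp: free_module_def hcomp_def polys_pfilter poly_mapping_eq_iff fun_eq_iff coef_pfilter)

text \<open>Any preimage may be replaced by its component of the right degree, since homogeneous
  maps commute with taking components.\<close>

lemma lift_homog:
  assumes b: "\<And>l. l < N \<Longrightarrow> homog \<tau> (\<tau>' l) (b l)"
    and z: "z \<in> gmap b N ` free_module V N" "homog (\<lambda>m. \<tau> m + s) e z"
  shows "\<exists>c\<in>free_module V N. homog (\<lambda>l. \<tau>' l + s) e c \<and> gmap b N c = z"
proof -
  obtain c where c: "c \<in> free_module V N" "z = gmap b N c" using z(1) by blast
  have "gmap b N (hcomp (\<lambda>l. \<tau>' l + s) e c) = z"
    by (subst gmap_hcomp[where \<tau> = \<tau>]) (simp_all add: b hcomp_id[OF z(2)] flip: c(2))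
  then show ?thesis
    using hcomp_free[OF c(1)] homog_hcomp by blast
qed

context koszul
begin

definition kd :: "('v set \<Rightarrow> nat \<Rightarrow> ('v, 'k::field) mpoly) \<Rightarrow> 'v set \<Rightarrow> nat \<Rightarrow> ('v, 'k) mpoly" where
  "kd w S = (\<lambda>l. kd1 (\<lambda>S. w S l) S)"

text \<open>\<open>w S\<close> is the coefficient of the basis element \<open>e\<^sub>S\<close> of the Koszul complex, which has degree
  \<open>card S\<close>; \<open>D\<close> is the total degree.\<close>

definition kchain ::
  "(nat \<Rightarrow> nat) \<Rightarrow> (nat \<Rightarrow> ('v, 'k::field) mpoly) set \<Rightarrow> nat \<Rightarrow> nat \<Rightarrow> ('v set \<Rightarrow> nat \<Rightarrow> ('v, 'k) mpoly) \<Rightarrow> bool" where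
  "kchain \<tau> M q D w \<longleftrightarrow> (\<forall>S. w S \<in> M \<and> homog (\<lambda>l. \<tau> l + card S) D (w S) \<and>
     (w S \<noteq> 0 \<longrightarrow> S \<subseteq> V \<and> card S = q))"

text \<open>Vanishing of Koszul homology in homological degree \<open>q\<close> and total degree
  \<open>D\<close>, as "every cycle is a boundary". No quotient is formed, because only whether a
  Betti number is nonzero matters for the regularity.\<close>

definition kvanish :: "(nat \<Rightarrow> nat) \<Rightarrow> (nat \<Rightarrow> ('v, 'k::field) mpoly) set \<Rightarrow> nat \<Rightarrow> nat \<Rightarrow> bool" where
  "kvanish \<tau> M q D \<longleftrightarrow> (\<forall>w. kchain \<tau> M q D w \<and> (\<forall>S. kd w S = 0) \<longrightarrow>
     (\<exists>h. kchain \<tau> M (Suc q) D h \<and> (\<forall>S. kd h S = w S)))"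

lemma kd_0 [simp]: "kd (\<lambda>_. 0) S = 0"
  by (simp add: kd_def kd1_def fun_eq_iff)

lemma kd_diff: "kd (\<lambda>S. w S - h S) S = kd w S - kd h S"
  by (simp add: kd_def kd1_def fun_eq_iff right_diff_distrib sum_subtractf)

lemma gmap_kd: "gmap b N (kd w S) = kd (\<lambda>S. gmap b N (w S)) S"
proof
  fix m
  have "gmap b N (kd w S) m =
      (\<Sum>l<N. \<Sum>x\<in>V - S. ksgn f x S * (var x * (w (insert x S) l * b l m)))"
    unfolding gmap_def kd_def kd1_def sum_distrib_right
    by (intro sum.cong refl) (simp add: mult.assoc)
  also have "\<dots> = (\<Sum>x\<in>V - S. ksgn f x S * (var x * (\<Sum>l<N. w (insert x S) l * b l m)))"
    unfolding sum_distrib_left by (rule sum.swap)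
  finally show "gmap b N (kd w S) m = kd (\<lambda>S. gmap b N (w S)) S m"
    by (simp add: kd_def kd1_def gmap_def)
qed

lemma kchain_kd:
  assumes M: "submod V M" and w: "kchain \<tau> M (Suc q) D w"
  shows "kchain \<tau> M q D (kd w)"
  unfolding kchain_def
proof (intro allI conjI)
  fix S
  have "(\<lambda>l. \<Sum>x\<in>V - S. (ksgn f x S * var x) * w (insert x S) l) \<in> M"
    using w by (intro submod_sum[OF M] submod_mult[OF M]) (auto simp: kchain_def)
  then show "kd w S \<in> M" by (simp add: kd_def kd1_def mult.assoc)
  have ins: "x \<notin> S \<and> card (insert x S) = Suc (card S) \<and> S \<subseteq> V \<and> card S = q"
    if "x \<in> V - S" "w (insert x S) \<noteq> 0" for x
  proof -
    have *: "insert x S \<subseteq> V" "card (insert x S) = Suc q" using w that by (auto simp: kchain_def)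
    then have "finite S" using finite_subset[OF _ finite_V, of S] by auto
    with * that show ?thesis by auto
  qed
  show "homog (\<lambda>l. \<tau> l + card S) D (kd w S)"
    unfolding homog_def
  proof (intro allI ballI)
    fix l t assume "t \<in> supp (kd w S l)"
    then obtain x where x: "x \<in> V - S" "t \<in> supp (var x * w (insert x S) l)"
      using supp_sum[of "\<lambda>x. ksgn f x S * (var x * w (insert x S) l)" "V - S"]
      by (auto simp: kd_def kd1_def)
    then obtain u where u: "t = monom x 1 + u" "u \<in> supp (w (insert x S) l)"
      using keys_mult[of "var x" "w (insert x S) l"] by (auto simp: var_def)
    then have "w (insert x S) \<noteq> 0" by auto
    with ins[OF x(1)] have "card (insert x S) = Suc (card S)" by blast
    moreover have "exp_degree u + (\<tau> l + card (insert x S)) = D"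
      using w u(2) by (auto simp: kchain_def homog_def)
    ultimately show "exp_degree t + (\<tau> l + card S) = D"
      using exp_degree_monom[of x] by (simp add: u(1) exp_degree_add)
  qed
  show "kd w S \<noteq> 0 \<longrightarrow> S \<subseteq> V \<and> card S = q"
  proof
    assume "kd w S \<noteq> 0"
    moreover have "kd w S = 0" if "\<And>x. x \<in> V - S \<Longrightarrow> w (insert x S) = 0"
      using that by (simp add: kd_def kd1_def fun_eq_iff)
    ultimately obtain x where "x \<in> V - S" "w (insert x S) \<noteq> 0" by blast
    then show "S \<subseteq> V \<and> card S = q" using ins by blast
  qed
qed

lemma kd_kd: "kchain \<tau> M q D w \<Longrightarrow> kd (kd w) S = 0"
proof (cases "S \<subseteq> V")
  case True then show ?thesis by (simp add: kd_def kd1_kd1 zero_fun_def)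
next
  case False
  assume w: "kchain \<tau> M q D w"
  have 0: "w (insert y T) = 0" if "\<not> T \<subseteq> V" for y T
    using w that by (auto simp: kchain_def)
  have 1: "kd w T = 0" if "\<not> T \<subseteq> V" for T
    using 0[OF that] by (simp add: kd_def kd1_def fun_eq_iff)
  have "kd w (insert x S) = 0" for x using False by (intro 1) auto
  then show ?thesis by (simp add: kd_def[of "kd w"] kd1_def fun_eq_iff)
qed

lemma kchain_diff:
  assumes "submod V M" "kchain \<tau> M q D w" "kchain \<tau> M q D h"
  shows "kchain \<tau> M q D (\<lambda>S. w S - h S)"
  unfolding kchain_def
proof (intro allI conjI)
  fix S
  show "w S - h S \<in> M" "homog (\<lambda>l. \<tau> l + card S) D (w S - h S)"
    using assms by (auto simp: kchain_def intro: submod_diff homog_diff)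
  show "w S - h S \<noteq> 0 \<longrightarrow> S \<subseteq> V \<and> card S = q"
  proof
    assume "w S - h S \<noteq> 0"
    then have "w S \<noteq> 0 \<or> h S \<noteq> 0" by (metis diff_self)
    then show "S \<subseteq> V \<and> card S = q" using assms(2,3) unfolding kchain_def by blast
  qed
qed

lemma kchain_mono: "kchain \<tau> M q D w \<Longrightarrow> M \<subseteq> M' \<Longrightarrow> kchain \<tau> M' q D w"
  by (auto simp: kchain_def)

lemma kchain_gmap:
  assumes "kchain \<tau>' (free_module V N) q D w" "\<And>l. l < N \<Longrightarrow> homog \<tau> (\<tau>' l) (b l)"
  shows "kchain \<tau> (gmap b N ` free_module V N) q D (\<lambda>S. gmap b N (w S))"
  unfolding kchain_def
proof (intro allI conjI impI)
  fix S
  show "gmap b N (w S) \<in> gmap b N ` free_module V N" using assms(1) by (auto simp: kchain_def)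
  show "homog (\<lambda>l. \<tau> l + card S) D (gmap b N (w S))"
    using assms by (intro homog_gmap) (auto simp: kchain_def)
  assume "gmap b N (w S) \<noteq> 0"
  then have "w S \<noteq> 0" by auto
  then show "S \<subseteq> V" "card S = q" using assms(1) by (auto simp: kchain_def)
qed

text \<open>The lift is made separately for each set, with 0 lifted to 0; otherwise it could acquire
  coefficients at sets of the wrong size.\<close>

lemma kchain_lift:
  assumes b: "\<And>l. l < N \<Longrightarrow> homog \<tau> (\<tau>' l) (b l)"
    and z: "kchain \<tau> (gmap b N ` free_module V N) q D z"
  obtains c where "kchain \<tau>' (free_module V N) q D c" "\<And>S. gmap b N (c S) = z S"
proof -
  have "\<exists>c\<in>free_module V N. homog (\<lambda>l. \<tau>' l + card S) D c \<and> gmap b N c = z S \<and> (z S = 0 \<longrightarrow> c = 0)" for S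
  proof (cases "z S = 0")
    case True
    then show ?thesis by (intro bexI[of _ 0]) (auto intro: submod_0[OF submod_free])
  next
    case False
    with lift_homog[OF b, where s = "card S" and e = D and z = "z S" and V = V] z
    show ?thesis by (auto simp: kchain_def)
  qed
  then obtain c where "\<And>S. c S \<in> free_module V N \<and> homog (\<lambda>l. \<tau>' l + card S) D (c S)
      \<and> gmap b N (c S) = z S \<and> (z S = 0 \<longrightarrow> c S = 0)"
    by metis
  then show ?thesis
    using z by (intro that[of c]) (auto simp: kchain_def)
qed

text \<open>For a free module the faces in multidegree \<open>a\<close> are all subsets of the
  support of \<open>a\<close>. This full simplex is a cone over any of its vertices unless
  \<open>a\<close> is 0, the case that \<open>nz\<close> excludes.\<close>

lemma free_boundary:
  assumes w: "kchain \<tau> (free_module V N) q D w" "\<And>S. kd w S = 0"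
    and nz: "\<And>S l t. t \<in> supp (w S l) \<Longrightarrow> t + sqexp S \<noteq> 0"
  shows "\<exists>h. kchain \<tau> (free_module V N) (Suc q) D h \<and> (\<forall>S. kd h S = w S)"
proof -
  define \<xi> where "\<xi> a = (SOME x. x \<in> supp a)" for a :: "'v \<Rightarrow>\<^sub>0 nat"
  have \<xi>: "\<xi> a \<in> supp a" if "a \<noteq> 0" for a
    unfolding \<xi>_def using that by (intro someI_ex[of "\<lambda>x. x \<in> supp a"]) (simp add: ex_in_conv supp_empty_iff)
  have "\<exists>h. (\<forall>S. kd1 h S = w S l) \<and> (\<forall>S. \<forall>t\<in>supp (h S). S \<subseteq> V \<and>
      (\<exists>x\<in>S. t + monom x 1 \<in> supp (w (S - {x}) l))) \<and> (l \<ge> N \<longrightarrow> h = 0)" for l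
  proof (cases "l \<ge> N")
    case True
    then have "w S l = 0" for S using w(1) by (auto simp: kchain_def free_module_def)
    then show ?thesis by (intro exI[of _ 0]) (auto simp: kd1_def)
  next
    case False
    have 1: "S \<subseteq> V" if "w S l \<noteq> 0" for S
      using w(1) that by (auto simp: kchain_def) (metis subsetD zero_fun_apply)
    have 2: "w S l \<in> polys V" for S
      using w(1) by (auto simp: kchain_def free_module_def)
    have 3: "kd1 (\<lambda>S. w S l) S = 0" for S
      using w(2)[of S] by (simp add: kd_def fun_eq_iff)
    have 4: "\<xi> (t + sqexp S) \<in> supp (t + sqexp S)" if "t \<in> supp (w S l)" for S t
      using that by (intro \<xi> nz)
    show ?thesis
      using cone[of "\<lambda>S. w S l" \<xi>, OF 1 2 3 4] False by blast
  qed
  then obtain h where h: "\<And>l S. kd1 (h l) S = w S l"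
    "\<And>l S t. t \<in> supp (h l S) \<Longrightarrow> S \<subseteq> V \<and> (\<exists>x\<in>S. t + monom x 1 \<in> supp (w (S - {x}) l))"
    "\<And>l. l \<ge> N \<Longrightarrow> h l = 0"
    by metis
  have card: "card S = Suc q \<and> card S = Suc (card (S - {x}))"
    if "S \<subseteq> V" "x \<in> S" "t \<in> supp (w (S - {x}) l)" for S x t l
  proof -
    have "w (S - {x}) \<noteq> 0" using that by auto
    then have "card (S - {x}) = q" using w(1) by (auto simp: kchain_def)
    moreover have "finite S" using that finite_V finite_subset by blast
    ultimately show ?thesis using that by (metis card_Suc_Diff1)
  qed
  have "kchain \<tau> (free_module V N) (Suc q) D (\<lambda>S l. h l S)"
    unfolding kchain_def
  proof (intro allI conjI)
    fix S
    have "h l S \<in> polys V" for l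
      unfolding polys_def
    proof safe
      fix t x assume "t \<in> supp (h l S)" and x: "x \<in> supp t"
      with h(2) obtain y where "t + monom y 1 \<in> supp (w (S - {y}) l)" by blast
      moreover have "w (S - {y}) l \<in> polys V" using w(1) by (auto simp: kchain_def free_module_def)
      ultimately have "supp (t + monom y 1) \<subseteq> V" by (auto simp: polys_def)
      then show "x \<in> V" using x by (auto simp: supp_add_nat)
    qed
    then show "(\<lambda>l. h l S) \<in> free_module V N" using h(3) by (auto simp: free_module_def)
    show "homog (\<lambda>l. \<tau> l + card S) D (\<lambda>l. h l S)"
      unfolding homog_def
    proof (intro allI ballI)
      fix l t assume "t \<in> supp (h l S)"
      with h(2) obtain y where y: "S \<subseteq> V" "y \<in> S" "t + monom y 1 \<in> supp (w (S - {y}) l)" by blast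
      then have "exp_degree (t + monom y 1) + (\<tau> l + card (S - {y})) = D"
        using w(1) unfolding kchain_def homog_def by blast
      then show "exp_degree t + (\<tau> l + card S) = D"
        using card[OF y] exp_degree_monom[of y] by (simp add: exp_degree_add)
    qed
    show "(\<lambda>l. h l S) \<noteq> 0 \<longrightarrow> S \<subseteq> V \<and> card S = Suc q"
    proof
      assume "(\<lambda>l. h l S) \<noteq> 0"
      then obtain l where "h l S \<noteq> 0" by (auto simp: fun_eq_iff)
      then obtain t where "t \<in> supp (h l S)" using supp_empty_iff by blast
      with h(2) obtain y where y: "S \<subseteq> V" "y \<in> S" "t + monom y 1 \<in> supp (w (S - {y}) l)" by blast
      then show "S \<subseteq> V \<and> card S = Suc q" using card[OF y] by simp
    qed
  qed
  moreover have "\<forall>S. kd (\<lambda>S l. h l S) S = w S"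
    using h(1) by (simp add: kd_def)
  ultimately show ?thesis by blast
qed

lemma kvanish_free:
  assumes "q > 0" shows "kvanish \<tau> (free_module V N) q D"
  unfolding kvanish_def
proof (intro allI impI, elim conjE)
  fix w assume w: "kchain \<tau> (free_module V N) q D w" "\<forall>S. kd w S = 0"
  show "\<exists>h. kchain \<tau> (free_module V N) (Suc q) D h \<and> (\<forall>S. kd h S = w S)"
  proof (rule free_boundary[OF w(1)])
    show "kd w S = 0" for S using w(2) by blast
    fix S l t assume "t \<in> supp (w S l)"
    then have "w S \<noteq> 0" by auto
    then have S: "S \<subseteq> V" "card S = q" using w(1) by (auto simp: kchain_def)
    then have "finite S" "S \<noteq> {}" using assms by (auto intro: card_ge_0_finite)
    then have "supp (t + sqexp S) \<noteq> {}" by (auto simp: supp_add_nat supp_sqexp)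
    then show "t + sqexp S \<noteq> 0" by auto
  qed
qed

text \<open>The connecting homomorphism by hand: the boundary of a lift \<open>c\<close> is a cycle
  in the kernel, hence the boundary of some \<open>y\<close> there, and \<open>c - y\<close> is a
  cycle of positive homological degree in the free module, where it bounds.\<close>

lemma kvanish_image:
  assumes b: "\<And>l. l < N \<Longrightarrow> homog \<tau> (\<tau>' l) (b l)"
    and ker: "kvanish \<tau>' {c \<in> free_module V N. gmap b N c = 0} q D"
  shows "kvanish \<tau> (gmap b N ` free_module V N) (Suc q) D"
  unfolding kvanish_def
proof (intro allI impI, elim conjE)
  let ?F = "free_module V N" and ?Z = "{c \<in> free_module V N. gmap b N c = 0}"
  fix z assume z: "kchain \<tau> (gmap b N ` ?F) (Suc q) D z" "\<forall>S. kd z S = 0"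
  obtain c where c: "kchain \<tau>' ?F (Suc q) D c" "\<And>S. gmap b N (c S) = z S"
    using kchain_lift[OF b z(1)] by blast
  have "gmap b N (kd c S) = 0" for S
    using z(2) by (simp add: gmap_kd c(2))
  then have "kchain \<tau>' ?Z q D (kd c)"
    using kchain_kd[OF submod_free c(1)] by (auto simp: kchain_def)
  then obtain y where y: "kchain \<tau>' ?Z (Suc q) D y" "\<And>S. kd y S = kd c S"
    using ker kd_kd[OF c(1)] by (auto simp: kvanish_def)
  define x where "x = (\<lambda>S. c S - y S)"
  have "kchain \<tau>' ?F (Suc q) D x"
    unfolding x_def by (intro kchain_diff submod_free c(1) kchain_mono[OF y(1)]) auto
  moreover have "kd x S = 0" for S by (simp add: x_def kd_diff y(2))
  ultimately obtain h where h: "kchain \<tau>' ?F (Suc (Suc q)) D h" "\<And>S. kd h S = x S"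
    using kvanish_free[of "Suc q" \<tau>' N D] unfolding kvanish_def by blast
  have "gmap b N (y S) = 0" for S using y(1) by (simp add: kchain_def)
  then have "kd (\<lambda>S. gmap b N (h S)) S = z S" for S
    by (simp add: gmap_kd[symmetric] h(2) x_def gmap_diff c(2))
  with kchain_gmap[OF h(1) b]
  show "\<exists>h. kchain \<tau> (gmap b N ` ?F) (Suc (Suc q)) D h \<and> (\<forall>S. kd h S = z S)"
    by (intro exI[of _ "\<lambda>S. gmap b N (h S)"]) blast
qed

text \<open>The converse shift. A cycle in the kernel bounds some \<open>w\<close> in the free
  module, and the image of \<open>w\<close> is a cycle, whose bounding chain is used to correct
  \<open>w\<close>. For q = 0 the free module does have homology, carried by constants;
  \<open>minimal\<close> keeps the kernel clear of them.\<close>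

lemma kvanish_kernel:
  assumes b: "\<And>l. l < N \<Longrightarrow> homog \<tau> (\<tau>' l) (b l)"
    and im: "kvanish \<tau> (gmap b N ` free_module V N) (Suc q) D"
    and minimal: "\<And>c l. c \<in> free_module V N \<Longrightarrow> gmap b N c = 0 \<Longrightarrow> coef (c l) 0 = 0"
  shows "kvanish \<tau>' {c \<in> free_module V N. gmap b N c = 0} q D"
  unfolding kvanish_def
proof (intro allI impI, elim conjE)
  let ?F = "free_module V N" and ?Z = "{c \<in> free_module V N. gmap b N c = 0}"
  fix z assume z: "kchain \<tau>' ?Z q D z" "\<forall>S. kd z S = 0"
  have z': "kchain \<tau>' ?F q D z" using z(1) by (rule kchain_mono) auto
  obtain w where w: "kchain \<tau>' ?F (Suc q) D w" "\<And>S. kd w S = z S"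
  proof -
    have "t + sqexp S \<noteq> 0" if "t \<in> supp (z S l)" for S l t
    proof
      assume "t + sqexp S = 0"
      then have "supp t = {}" using supp_add_nat[of t "sqexp S"] by simp
      then have "t = 0" by (simp add: supp_empty_iff)
      then show False using z(1) minimal[of "z S" l] that by (auto simp: kchain_def in_keys_iff)
    qed
    then show ?thesis using free_boundary[OF z'] z(2) that by blast
  qed
  have "gmap b N (z S) = 0" for S using z(1) by (simp add: kchain_def)
  then have cyc: "kd (\<lambda>S. gmap b N (w S)) S = 0" for S
    by (simp add: gmap_kd[symmetric] w(2))
  obtain y where y: "kchain \<tau> (gmap b N ` ?F) (Suc (Suc q)) D y" "\<And>S. kd y S = gmap b N (w S)"
    using im kchain_gmap[OF w(1) b] cyc unfolding kvanish_def by blast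
  obtain c where c: "kchain \<tau>' ?F (Suc (Suc q)) D c" "\<And>S. gmap b N (c S) = y S"
    using kchain_lift[OF b y(1)] by blast
  define h where "h = (\<lambda>S. w S - kd c S)"
  have "kchain \<tau>' ?F (Suc q) D h"
    unfolding h_def by (intro kchain_diff submod_free w(1) kchain_kd c(1))
  moreover have "gmap b N (h S) = 0" for S
    by (simp add: h_def gmap_diff gmap_kd c(2) y(2))
  ultimately have "kchain \<tau>' ?Z (Suc q) D h" by (simp add: kchain_def)
  moreover have "kd h S = z S" for S
    by (simp add: h_def kd_diff w(2) kd_kd[OF c(1)])
  ultimately show "\<exists>h. kchain \<tau>' ?Z (Suc q) D h \<and> (\<forall>S. kd h S = z S)" by blast
qed

lemma kvanish_above_card:
  assumes "0 \<in> M" "card V < q" shows "kvanish \<tau> M q D"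
  unfolding kvanish_def
proof (intro allI impI, elim conjE)
  fix w assume w: "kchain \<tau> M q D w"
  have "w S = 0" for S
    using w assms(2) card_mono[OF finite_V, of S] by (force simp: kchain_def)
  then show "\<exists>h. kchain \<tau> M (Suc q) D h \<and> (\<forall>S. kd h S = w S)"
    using assms(1) by (intro exI[of _ "\<lambda>_. 0"]) (simp add: kchain_def)
qed

end

section \<open>Minimal generators\<close>

definition mspan :: "'v set \<Rightarrow> (nat \<Rightarrow> ('v, 'k::field) mpoly) set \<Rightarrow> (nat \<Rightarrow> ('v, 'k) mpoly) set" where
  "mspan V G = \<Inter>{M. submod V M \<and> G \<subseteq> M}"

lemma submod_mspan: "submod V (mspan V G)"
  unfolding mspan_def submod_def by blast

lemma mspan_superset: "G \<subseteq> mspan V G"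
  by (auto simp: mspan_def)

lemma mspan_subset: "submod V M \<Longrightarrow> G \<subseteq> M \<Longrightarrow> mspan V G \<subseteq> M"
  by (auto simp: mspan_def)

lemma mspan_mono: "G \<subseteq> G' \<Longrightarrow> mspan V G \<subseteq> mspan V G'"
  by (auto simp: mspan_def)

lemma gmap_unit: "l < N \<Longrightarrow> gmap b N (\<lambda>m. if m = l then 1 else 0) = b l"
  by (simp add: gmap_def fun_eq_iff if_distrib[of "\<lambda>c. c * _"] cong: if_cong)

lemma unit_free: "l < N \<Longrightarrow> (\<lambda>m. if m = l then 1 else 0) \<in> free_module V N"
  by (simp add: free_module_def)

lemma finite_bounded_exps:
  assumes "finite V" shows "finite {t :: 'v \<Rightarrow>\<^sub>0 nat. supp t \<subseteq> V \<and> exp_degree t \<le> D}" (is "finite ?T")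
proof -
  have "coef ` ?T \<subseteq> {f. \<forall>x. (x \<in> V \<longrightarrow> f x \<in> {..D}) \<and> (x \<notin> V \<longrightarrow> f x = 0)}"
  proof (rule image_subsetI)
    fix t :: "'v \<Rightarrow>\<^sub>0 nat" assume "t \<in> ?T"
    then have t: "supp t \<subseteq> V" "exp_degree t \<le> D" by auto
    have "coef t x \<in> {..D}" if "x \<in> V" for x
      using member_le_sum[of x V "coef t"] assms t that by (simp add: exp_degree_superset)
    moreover have "coef t x = 0" if "x \<notin> V" for x
      using t that by (auto simp: in_keys_iff)
    ultimately show "coef t \<in> {f. \<forall>x. (x \<in> V \<longrightarrow> f x \<in> {..D}) \<and> (x \<notin> V \<longrightarrow> f x = 0)}" by blast
  qed
  moreover have "finite {f. \<forall>x. (x \<in> V \<longrightarrow> f x \<in> {..D}) \<and> (x \<notin> V \<longrightarrow> f x = (0::nat))}"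
    using assms by (intro finite_set_of_finite_funs) auto
  ultimately have "finite (coef ` ?T)" by (rule finite_subset)
  then show ?thesis
    by (rule finite_imageD) (auto intro: inj_onI poly_mapping_eqI)
qed

lemma sum_fun_apply: "(\<Sum>i\<in>A. g i) m = (\<Sum>i\<in>A. g i m)"
  by (induction A rule: infinite_finite_induct) auto

text \<open>A homogeneous piece lies in the span, over the field, of finitely many monomials times
  basis elements, so a maximal independent subset of it is finite.\<close>

lemma homog_finite_span:
  fixes Z :: "(nat \<Rightarrow> ('v, 'k::field) mpoly) set"
  assumes V: "finite V" and Z: "Z \<subseteq> free_module V N"
  shows "\<exists>B. finite B \<and> B \<subseteq> {z \<in> Z. homog \<tau> D z} \<and> {z \<in> Z. homog \<tau> D z} \<subseteq> mspan V B"
proof -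
  define scale where "scale = (\<lambda>(a::'k) (c :: nat \<Rightarrow> ('v, 'k) mpoly) l. monom 0 a * c l)"
  interpret vs: vector_space scale
    by unfold_locales
      (auto simp: scale_def fun_eq_iff distrib_left distrib_right single_add mult_single simp flip: mult.assoc)
  have span_mspan: "vs.span B \<subseteq> mspan V B" for B
  proof (rule vs.span_minimal[OF mspan_superset])
    show "vs.subspace (mspan V B)"
      using submod_mspan[of V B]
      by (intro vs.subspaceI) (auto simp: scale_def intro: submod_0 submod_add submod_mult)
  qed
  define T where "T = {t :: 'v \<Rightarrow>\<^sub>0 nat. supp t \<subseteq> V \<and> exp_degree t \<le> D}"
  define e where "e = (\<lambda>(l::nat, t) m. if m = l then monom t 1 else (0 :: ('v, 'k) mpoly))"
  have finT: "finite T" unfolding T_def by (rule finite_bounded_exps[OF V])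
  have "{z \<in> Z. homog \<tau> D z} \<subseteq> vs.span (e ` ({..<N} \<times> T))"
  proof safe
    fix z assume z: "z \<in> Z" "homog \<tau> D z"
    have 1: "supp (z l) \<subseteq> T" for l
      using z Z by (fastforce simp: T_def homog_def free_module_def polys_def)
    have "z = (\<Sum>l<N. \<Sum>t\<in>T. scale (coef (z l) t) (e (l, t)))"
    proof
      fix m
      have "(\<Sum>l<N. \<Sum>t\<in>T. scale (coef (z l) t) (e (l, t))) m
        = (\<Sum>l<N. \<Sum>t\<in>T. if m = l then monom t (coef (z l) t) else 0)"
        unfolding sum_fun_apply by (intro sum.cong refl) (simp add: scale_def e_def mult_single)
      also have "\<dots> = (\<Sum>l<N. if m = l then (\<Sum>t\<in>T. monom t (coef (z l) t)) else 0)"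
        by (intro sum.cong refl) auto
      also have "\<dots> = (if m < N then (\<Sum>t\<in>T. monom t (coef (z m) t)) else 0)"
        by (simp add: sum.delta)
      also have "\<dots> = z m"
      proof (cases "m < N")
        case True
        have "(\<Sum>t\<in>T. monom t (coef (z m) t)) = (\<Sum>t\<in>supp (z m). monom t (coef (z m) t))"
          using 1 finT by (intro sum.mono_neutral_right) (auto simp: in_keys_iff)
        then show ?thesis using True mpoly_eq_sum_monom[of "z m"] by simp
      next
        case False
        then show ?thesis using z(1) Z by (auto simp: free_module_def)
      qed
      finally show "z m = (\<Sum>l<N. \<Sum>t\<in>T. scale (coef (z l) t) (e (l, t))) m" by simp
    qed
    also have "\<dots> \<in> vs.span (e ` ({..<N} \<times> T))"
      by (intro vs.span_sum vs.span_scale vs.span_base) auto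
    finally show "z \<in> vs.span (e ` ({..<N} \<times> T))" .
  qed
  moreover obtain B where B: "B \<subseteq> {z \<in> Z. homog \<tau> D z}" "vs.independent B" "{z \<in> Z. homog \<tau> D z} \<subseteq> vs.span B"
    by (rule vs.maximal_independent_subset)
  ultimately have "finite B"
    using vs.independent_span_bound[of "e ` ({..<N} \<times> T)" B] finT by blast
  then show ?thesis using B span_mspan by blast
qed

lemma hcomp_decomp:
  assumes c: "c \<in> free_module V N"
  obtains E where "finite E" "c = (\<lambda>l. \<Sum>e\<in>E. hcomp \<tau> e c l)"
proof
  define E where "E = (\<Union>l<N. (\<lambda>t. exp_degree t + \<tau> l) ` supp (c l))"
  show finE: "finite E" by (simp add: E_def)
  show "c = (\<lambda>l. \<Sum>e\<in>E. hcomp \<tau> e c l)"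
  proof
    fix l
    show "c l = (\<Sum>e\<in>E. hcomp \<tau> e c l)"
    proof (rule poly_mapping_eqI)
      fix t
      have "coef (\<Sum>e\<in>E. hcomp \<tau> e c l) t = (\<Sum>e\<in>E. if exp_degree t + \<tau> l = e then coef (c l) t else 0)"
        by (simp add: lookup_sum hcomp_def coef_pfilter)
      also have "\<dots> = (if exp_degree t + \<tau> l \<in> E then coef (c l) t else 0)"
        using finE by (simp add: sum.delta)
      also have "\<dots> = coef (c l) t"
      proof (cases "t \<in> supp (c l)")
        case True
        then have "l < N" using c by (force simp: free_module_def simp flip: not_le)
        then show ?thesis using True by (auto simp: E_def)
      qed (simp add: in_keys_iff)
      finally show "coef (c l) t = coef (\<Sum>e\<in>E. hcomp \<tau> e c l) t" by simp
    qed
  qed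
qed

context koszul
begin

text \<open>In homological degree 0 every element is a cycle, and the boundaries are the
  combinations of the variables with coefficients in \<open>M\<close>. The degree of
  \<open>y x\<close> is D - 1, written without subtraction.\<close>

lemma kvanish_0:
  assumes kv: "kvanish \<tau> M 0 D" and M: "0 \<in> M" and z: "z \<in> M" "homog \<tau> D z"
  shows "\<exists>y. (\<forall>x. y x \<in> M \<and> homog (\<lambda>l. Suc (\<tau> l)) D (y x)) \<and> z = (\<lambda>l. \<Sum>x\<in>V. var x * y x l)"
proof -
  define w where "w = (\<lambda>S :: 'v set. if S = {} then z else 0)"
  have "kchain \<tau> M 0 D w" using M z by (auto simp: kchain_def w_def)
  moreover have "kd w S = 0" for S
    by (simp add: kd_def kd1_def w_def zero_fun_def)
  ultimately obtain h where h: "kchain \<tau> M (Suc 0) D h" "\<And>S. kd h S = w S"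
    using kv by (auto simp: kvanish_def)
  have "h {x} \<in> M \<and> homog (\<lambda>l. Suc (\<tau> l)) D (h {x})" for x
    using h(1)[unfolded kchain_def, rule_format, of "{x}"] by simp
  moreover have "z = (\<lambda>l. \<Sum>x\<in>V. var x * h {x} l)"
    using h(2)[of "{}"] by (simp add: w_def kd_def kd1_def ksgn_def fun_eq_iff)
  ultimately show ?thesis by (intro exI[of _ "\<lambda>x. h {x}"]) blast
qed

text \<open>Induction on the degree: above \<open>n\<close>, \<open>kvanish_0\<close> reduces to
  degree one less, so finite spanning sets of the pieces of degree at most \<open>n\<close>
  suffice.\<close>

lemma finite_generation:
  assumes M: "submod V Z" "Z \<subseteq> free_module V N"
    and graded: "\<And>c e. c \<in> Z \<Longrightarrow> hcomp \<tau> e c \<in> Z"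
    and kv: "\<And>D. D > n \<Longrightarrow> kvanish \<tau> Z 0 D"
  shows "\<exists>G. finite G \<and> G \<subseteq> Z \<and> (\<forall>g\<in>G. \<exists>e. homog \<tau> e g) \<and> Z \<subseteq> mspan V G"
proof -
  have ex: "\<forall>D. \<exists>B. finite B \<and> B \<subseteq> {z \<in> Z. homog \<tau> D z} \<and> {z \<in> Z. homog \<tau> D z} \<subseteq> mspan V B"
    using homog_finite_span[OF finite_V M(2), of \<tau>] by blast
  obtain B where "\<forall>D. finite (B D) \<and> B D \<subseteq> {z \<in> Z. homog \<tau> D z} \<and> {z \<in> Z. homog \<tau> D z} \<subseteq> mspan V (B D)"
    by (rule exE[OF choice[OF ex]])
  then have B: "\<And>D. finite (B D)" "\<And>D. B D \<subseteq> {z \<in> Z. homog \<tau> D z}"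
    "\<And>D. {z \<in> Z. homog \<tau> D z} \<subseteq> mspan V (B D)" by blast+
  define G where "G = (\<Union>D\<le>n. B D)"
  have hom: "z \<in> mspan V G" if "z \<in> Z" "homog \<tau> D z" for z D
    using that
  proof (induction D arbitrary: z rule: less_induct)
    case (less D)
    show ?case
    proof (cases "D \<le> n")
      case True
      then have "mspan V (B D) \<subseteq> mspan V G" by (intro mspan_mono) (auto simp: G_def)
      then show ?thesis using B(3)[of D] less.prems by blast
    next
      case False
      then obtain y where y: "\<And>x. y x \<in> Z \<and> homog (\<lambda>l. Suc (\<tau> l)) D (y x)"
        and z: "z = (\<lambda>l. \<Sum>x\<in>V. var x * y x l)"
        using kvanish_0[OF kv submod_0[OF M(1)] less.prems] by auto
      have "y x \<in> mspan V G" for x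
      proof (rule less.IH)
        show "D - 1 < D" using False by simp
        show "homog \<tau> (D - 1) (y x)" using y[of x] by (force simp: homog_def)
      qed (use y in blast)
      then show ?thesis
        unfolding z by (intro submod_sum[OF submod_mspan] submod_mult[OF submod_mspan]) auto
    qed
  qed
  have "Z \<subseteq> mspan V G"
  proof
    fix z assume "z \<in> Z"
    then obtain E where E: "z = (\<lambda>l. \<Sum>e\<in>E. hcomp \<tau> e z l)"
      using hcomp_decomp M(2) by blast
    have "(\<lambda>l. \<Sum>e\<in>E. hcomp \<tau> e z l) \<in> mspan V G"
      using \<open>z \<in> Z\<close> by (intro submod_sum[OF submod_mspan] hom[OF graded homog_hcomp])
    then show "z \<in> mspan V G" using E by simp
  qed
  moreover have "finite G" using B(1) by (simp add: G_def)
  moreover have "G \<subseteq> Z" "\<forall>g\<in>G. \<exists>e. homog \<tau> e g" using B(2) unfolding G_def by blast+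
  ultimately show ?thesis by blast
qed

text \<open>Take a homogeneous generating set of least cardinality. A relation with a nonzero
  constant term at some generator would express that generator through the others.\<close>

lemma minimal_generators:
  fixes Z :: "(nat \<Rightarrow> ('v, 'k::field) mpoly) set"
  assumes M: "submod V Z" "Z \<subseteq> free_module V N"
    and graded: "\<And>c e. c \<in> Z \<Longrightarrow> hcomp \<tau> e c \<in> Z"
    and kv: "\<And>D. D > n \<Longrightarrow> kvanish \<tau> Z 0 D"
  shows "\<exists>N' \<tau>' b. (\<forall>l<N'. b l \<in> Z \<and> homog \<tau> (\<tau>' l) (b l)) \<and>
    gmap b N' ` free_module V N' = Z \<and>
    (\<forall>c\<in>free_module V N'. gmap b N' c = 0 \<longrightarrow> (\<forall>l. coef (c l) 0 = 0))"
proof -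
  define P where "P G \<longleftrightarrow> finite G \<and> G \<subseteq> Z \<and> (\<forall>g\<in>G. \<exists>e. homog \<tau> e g) \<and> Z \<subseteq> mspan V G" for G
  obtain G where G: "P G" "\<And>G'. P G' \<Longrightarrow> card G \<le> card G'"
  proof -
    have "\<exists>G. P G" unfolding P_def by (rule finite_generation[OF assms])
    then have "\<exists>G. P G \<and> (\<forall>G'. P G' \<longrightarrow> card G \<le> card G')"
      using ex_has_least_nat[of P _ card] by blast
    then show ?thesis using that by blast
  qed
  define N' where "N' = card G"
  obtain b where bij: "bij_betw b {0..<N'} G"
    using G(1) ex_bij_betw_nat_finite unfolding P_def N'_def by blast
  then have bG: "b l \<in> G" if "l < N'" for l using that by (auto simp: bij_betw_def)
  then have "\<forall>l. \<exists>e. l < N' \<longrightarrow> homog \<tau> e (b l)" using G(1) by (auto simp: P_def)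
  then obtain \<tau>' where \<tau>': "\<And>l. l < N' \<Longrightarrow> homog \<tau> (\<tau>' l) (b l)" by metis
  have bZ: "b l \<in> Z" if "l < N'" for l using bG[OF that] G(1) by (auto simp: P_def)
  show ?thesis
  proof (rule exI[of _ N'], rule exI[of _ \<tau>'], rule exI[of _ b], intro conjI allI impI ballI)
    show "gmap b N' ` free_module V N' = Z"
    proof
      show "gmap b N' ` free_module V N' \<subseteq> Z"
        by (auto simp: gmap_def free_module_def intro!: submod_sum[OF M(1)] submod_mult[OF M(1)] bZ)
      have "G \<subseteq> gmap b N' ` free_module V N'"
      proof
        fix g assume "g \<in> G"
        then obtain l where "l < N'" "g = b l" using bij by (auto simp: bij_betw_def)
        then show "g \<in> gmap b N' ` free_module V N'"
          using gmap_unit[of l N' b] unit_free[of l N' V] by force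
      qed
      then have "mspan V G \<subseteq> gmap b N' ` free_module V N'"
        by (intro mspan_subset submod_gmap_image)
      then show "Z \<subseteq> gmap b N' ` free_module V N'" using G(1) by (auto simp: P_def)
    qed
    show "coef (c l) 0 = 0" if c: "c \<in> free_module V N'" "gmap b N' c = 0" for c l
    proof (rule ccontr)
      define u where "u = coef (c l) 0"
      assume "coef (c l) 0 \<noteq> 0"
      then have u: "u \<noteq> 0" and "c l \<noteq> 0" by (auto simp: u_def)
      then have l: "l < N'" using c(1) by (force simp: free_module_def simp flip: not_le)
      \<comment> \<open>In this component of the relation the l-th coordinate has degree 0, hence is
        the constant \<open>u\<close>, and the relation can be solved for
        \<open>b l\<close>.\<close>
      define d where "d = hcomp \<tau>' (\<tau>' l) c"
      have "gmap b N' d = hcomp \<tau> (\<tau>' l) 0"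
        using gmap_hcomp[of N' \<tau> \<tau>' b 0 "\<tau>' l" c] \<tau>' c(2) by (simp add: d_def)
      also have "\<dots> = 0" by (rule hcomp_id) simp
      finally have d0: "gmap b N' d = 0" .
      have "d l = monom 0 (coef (d l) 0)"
        by (rule coef_const_mult_0) (simp add: d_def hcomp_def supp_pfilter exp_degree_0_iff)
      also have "coef (d l) 0 = u"
        by (simp add: d_def hcomp_def coef_pfilter u_def exp_degree_def)
      finally have dl: "d l = monom 0 u" .
      have sp: "(\<lambda>m. \<Sum>j\<in>{..<N'} - {l}. (monom 0 (- inverse u) * d j) * b j m) \<in> mspan V (G - {b l})"
      proof (intro submod_sum[OF submod_mspan] submod_mult[OF submod_mspan] polys_mult polys_const)
        fix j assume j: "j \<in> {..<N'} - {l}"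
        show "d j \<in> polys V" using hcomp_free[OF c(1)] by (auto simp: d_def free_module_def)
        have "b j \<in> G - {b l}"
          using j l bG inj_onD[OF bij_betw_imp_inj_on[OF bij], of j l] by auto
        then show "b j \<in> mspan V (G - {b l})" using mspan_superset[of "G - {b l}" V] by (rule rev_subsetD)
      qed
      have bl: "b l = (\<lambda>m. \<Sum>j\<in>{..<N'} - {l}. (monom 0 (- inverse u) * d j) * b j m)"
      proof
        fix m
        have "0 = (\<Sum>j<N'. d j * b j m)" using d0 by (simp add: gmap_def fun_eq_iff)
        also have "\<dots> = monom 0 u * b l m + (\<Sum>j\<in>{..<N'} - {l}. d j * b j m)"
          using l by (simp add: sum.remove[of _ l] dl)
        finally have s: "(\<Sum>j\<in>{..<N'} - {l}. d j * b j m) = - (monom 0 u * b l m)"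
          by (simp add: eq_neg_iff_add_eq_0 add.commute)
        have "(\<Sum>j\<in>{..<N'} - {l}. (monom 0 (- inverse u) * d j) * b j m)
            = monom 0 (- inverse u) * (\<Sum>j\<in>{..<N'} - {l}. d j * b j m)"
          by (simp add: sum_distrib_left mult.assoc)
        also have "\<dots> = (monom 0 (inverse u) * monom 0 u) * b l m"
          by (simp add: s single_uminus mult.assoc)
        also have "\<dots> = b l m" using u by (simp add: mult_single)
        finally show "b l m = (\<Sum>j\<in>{..<N'} - {l}. (monom 0 (- inverse u) * d j) * b j m)" by simp
      qed
      have "b l \<in> mspan V (G - {b l})" using sp bl by simp
      then have "G \<subseteq> mspan V (G - {b l})" using mspan_superset[of "G - {b l}" V] by blast
      then have "mspan V G \<subseteq> mspan V (G - {b l})" by (intro mspan_subset submod_mspan)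
      then have "P (G - {b l})" using G(1) by (auto simp: P_def)
      then have "card G \<le> card (G - {b l})" by (rule G(2))
      moreover have "card (G - {b l}) < card G"
        using G(1) bG[OF l] by (intro card_Diff1_less) (auto simp: P_def)
      ultimately show False by simp
    qed
  qed (simp_all add: bZ \<tau>')
qed

end

section \<open>Betti numbers and Koszul homology\<close>

text \<open>Embeds the ring as a free module of rank 1, so that an ideal becomes a submodule in the
  sense of \<open>submod\<close>.\<close>

definition coord0 :: "('v, 'k::field) mpoly \<Rightarrow> nat \<Rightarrow> ('v, 'k) mpoly" where
  "coord0 p = (\<lambda>m. if m = 0 then p else 0)"

definition graded_submod ::
  "'v set \<Rightarrow> nat \<Rightarrow> (nat \<Rightarrow> nat) \<Rightarrow> (nat \<Rightarrow> ('v, 'k::field) mpoly) set \<Rightarrow> bool" where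
  "graded_submod V N \<tau> Z \<longleftrightarrow>
     submod V Z \<and> Z \<subseteq> free_module V N \<and> (\<forall>c\<in>Z. \<forall>e. hcomp \<tau> e c \<in> Z)"

lemma coef_mult_0: "coef (p * q) 0 = coef p 0 * coef (q :: ('v, 'k::field) mpoly) 0"
proof -
  have *: "s + t = 0 \<longleftrightarrow> s = 0 \<and> t = 0" for s t :: "'v \<Rightarrow>\<^sub>0 nat"
    by (metis supp_add_nat supp_empty_iff Un_empty)
  have p: "p = monom 0 (coef p 0) + (p - monom 0 (coef p 0))" by simp
  have "0 \<notin> supp ((p - monom 0 (coef p 0)) * q)"
  proof
    assume "0 \<in> supp ((p - monom 0 (coef p 0)) * q)"
    then obtain s t where "0 = s + t" "s \<in> supp (p - monom 0 (coef p 0))"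
      using keys_mult[of "p - monom 0 (coef p 0)" q] by auto
    then have "0 \<in> supp (p - monom 0 (coef p 0))"
      using *[of s t] by simp
    then show False by (simp add: in_keys_iff lookup_minus)
  qed
  moreover have "coef (p * q) 0 = coef (monom 0 (coef p 0) * q) 0 + coef ((p - monom 0 (coef p 0)) * q) 0"
    by (metis p distrib_right lookup_add)
  ultimately show ?thesis by (simp add: coef_const_mult in_keys_iff)
qed

text \<open>The augmentation counts as one more boundary map: the module with index 0 is the ring, which
  contains the resolved ideal as \<open>coord0 ` J\<close>, and \<open>F\<^sub>i\<close> has index \<open>Suc i\<close>.\<close>

definition cx_rank :: "('v, 'k::field) free_complex \<Rightarrow> nat \<Rightarrow> nat" where
  "cx_rank F i = (case i of 0 \<Rightarrow> 1 | Suc j \<Rightarrow> frank F j)"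

definition cx_twist :: "('v, 'k::field) free_complex \<Rightarrow> nat \<Rightarrow> nat \<Rightarrow> nat" where
  "cx_twist F i = (case i of 0 \<Rightarrow> \<lambda>_. 0 | Suc j \<Rightarrow> twist F j)"

definition cx_map :: "('v, 'k::field) free_complex \<Rightarrow> nat \<Rightarrow> nat \<Rightarrow> nat \<Rightarrow> ('v, 'k) mpoly" where
  "cx_map F i = (case i of 0 \<Rightarrow> \<lambda>l. coord0 (aug F l) | Suc j \<Rightarrow> bdry F j)"

lemma gmap_coord0: "gmap (\<lambda>l. coord0 (aug F l)) (frank F 0) c = coord0 (aug_map F c)"
  by (simp add: gmap_def coord0_def aug_map_def fun_eq_iff)

lemma gmap_bdry: "gmap (bdry F i) (frank F (Suc i)) c = bdry_map F i c"
  by (simp add: gmap_def bdry_map_def)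

context koszul
begin

text \<open>With the ring at index 0, \<open>rim N B 0\<close> is the resolved ideal and
  \<open>rim N B i\<close> is its i-th syzygy module.\<close>

definition rim :: "(nat \<Rightarrow> nat) \<Rightarrow> (nat \<Rightarrow> nat \<Rightarrow> nat \<Rightarrow> ('v, 'k::field) mpoly) \<Rightarrow> nat \<Rightarrow> (nat \<Rightarrow> ('v, 'k) mpoly) set" where
  "rim N B i = gmap (B i) (N (Suc i)) ` free_module V (N (Suc i))"

definition rker :: "(nat \<Rightarrow> nat) \<Rightarrow> (nat \<Rightarrow> nat \<Rightarrow> nat \<Rightarrow> ('v, 'k::field) mpoly) \<Rightarrow> nat \<Rightarrow> (nat \<Rightarrow> ('v, 'k) mpoly) set" where
  "rker N B i = {c \<in> free_module V (N (Suc i)). gmap (B i) (N (Suc i)) c = 0}"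

definition resol ::
  "(nat \<Rightarrow> nat) \<Rightarrow> (nat \<Rightarrow> nat \<Rightarrow> nat) \<Rightarrow> (nat \<Rightarrow> nat \<Rightarrow> nat \<Rightarrow> ('v, 'k::field) mpoly) \<Rightarrow> bool" where
  "resol N \<tau> B \<longleftrightarrow> (\<forall>i. \<forall>l<N (Suc i). homog (\<tau> i) (\<tau> (Suc i) l) (B i l)) \<and>
     (\<forall>i. rim N B (Suc i) = rker N B i)"

text \<open>Stated for the kernels instead of the matrix entries, as \<open>kvanish_kernel\<close>
  consumes it; the kernel of the augmentation is the case i = 0.\<close>

definition minimal :: "(nat \<Rightarrow> nat) \<Rightarrow> (nat \<Rightarrow> nat \<Rightarrow> nat \<Rightarrow> ('v, 'k::field) mpoly) \<Rightarrow> bool" where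
  "minimal N B \<longleftrightarrow> (\<forall>i. \<forall>c\<in>rker N B i. \<forall>l. coef (c l) 0 = 0)"

text \<open>A constant term in a lift can only occur at a basis element of degree \<open>D\<close>.
  If there is none, the lift bounds in the free module by \<open>free_boundary\<close>, and so does
  its image.\<close>

lemma kvanish_image_0:
  assumes b: "\<And>l. l < N \<Longrightarrow> homog \<tau> (\<tau>' l) (b l)"
    and D: "\<And>l. l < N \<Longrightarrow> \<tau>' l \<noteq> D"
  shows "kvanish \<tau> (gmap b N ` free_module V N) 0 D"
  unfolding kvanish_def
proof (intro allI impI, elim conjE)
  fix z assume z: "kchain \<tau> (gmap b N ` free_module V N) 0 D z"
  obtain c where c: "kchain \<tau>' (free_module V N) 0 D c" "\<And>S. gmap b N (c S) = z S"
    using kchain_lift[OF b z] by blast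
  have c0: "S = {}" if "c S \<noteq> 0" for S
  proof -
    have "S \<subseteq> V" "card S = 0" using c(1) that by (auto simp: kchain_def)
    then show "S = {}" using finite_V finite_subset by (metis card_0_eq)
  qed
  have "\<exists>h. kchain \<tau>' (free_module V N) (Suc 0) D h \<and> (\<forall>S. kd h S = c S)"
  proof (rule free_boundary[OF c(1)])
    show "kd c S = 0" for S
    proof -
      have "c (insert x S) = 0" for x using c0[of "insert x S"] by auto
      then show ?thesis by (simp add: kd_def kd1_def fun_eq_iff)
    qed
    show "t + sqexp S \<noteq> 0" if t: "t \<in> supp (c S l)" for S l t
    proof
      assume "t + sqexp S = 0"
      then have "supp t = {}" using supp_add_nat[of t "sqexp S"] by simp
      then have "t = 0" by (simp add: supp_empty_iff)
      have "c S \<noteq> 0" "c S l \<noteq> 0" using t by auto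
      then have "S = {}" using c0 by blast
      moreover have "exp_degree t + (\<tau>' l + card S) = D"
        using c(1) t unfolding kchain_def homog_def by blast
      ultimately have "\<tau>' l = D" using \<open>t = 0\<close> by (simp add: exp_degree_def)
      moreover have "c S \<in> free_module V N" using c(1) by (auto simp: kchain_def)
      then have "l < N" using \<open>c S l \<noteq> 0\<close> by (force simp: free_module_def simp flip: not_le)
      ultimately show False using D by blast
    qed
  qed
  then obtain h where h: "kchain \<tau>' (free_module V N) (Suc 0) D h" "\<And>S. kd h S = c S" by blast
  show "\<exists>h. kchain \<tau> (gmap b N ` free_module V N) (Suc 0) D h \<and> (\<forall>S. kd h S = z S)"
    using kchain_gmap[OF h(1) b]
    by (intro exI[of _ "\<lambda>S. gmap b N (h S)"]) (simp add: gmap_kd[symmetric] h(2) c(2))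
qed

text \<open>Every step along the resolution trades one homological degree, so homology of the ideal
  in degree p becomes homology of the p-th syzygy module in degree 0, where generators are
  visible.\<close>

lemma kvanish_rim_down:
  assumes r: "resol N \<tau> B"
  shows "kvanish (\<tau> (i + j)) (rim N B (i + j)) q D \<Longrightarrow> kvanish (\<tau> i) (rim N B i) (q + j) D"
proof (induction j arbitrary: q)
  case (Suc j)
  have "kvanish (\<tau> (i + j)) (rim N B (i + j)) (Suc q) D"
    unfolding rim_def
  proof (rule kvanish_image)
    show "homog (\<tau> (i + j)) (\<tau> (Suc (i + j)) l) (B (i + j) l)" if "l < N (Suc (i + j))" for l
      using r that by (simp add: resol_def)
    show "kvanish (\<tau> (Suc (i + j))) {c \<in> free_module V (N (Suc (i + j))). gmap (B (i + j)) (N (Suc (i + j))) c = 0} q D"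
      using Suc.prems r by (simp add: resol_def rker_def)
  qed
  from Suc.IH[OF this] show ?case by simp
qed simp

lemma kvanish_rim_up:
  assumes r: "resol N \<tau> B" and m: "minimal N B"
  shows "kvanish (\<tau> i) (rim N B i) (q + j) D \<Longrightarrow> kvanish (\<tau> (i + j)) (rim N B (i + j)) q D"
proof (induction j arbitrary: q)
  case (Suc j)
  have 1: "kvanish (\<tau> (i + j)) (rim N B (i + j)) (Suc q) D"
    using Suc.prems by (intro Suc.IH) simp
  have "kvanish (\<tau> (Suc (i + j))) (rker N B (i + j)) q D"
    unfolding rker_def
  proof (rule kvanish_kernel)
    show "homog (\<tau> (i + j)) (\<tau> (Suc (i + j)) l) (B (i + j) l)" if "l < N (Suc (i + j))" for l
      using r that by (simp add: resol_def)
    show "kvanish (\<tau> (i + j)) (gmap (B (i + j)) (N (Suc (i + j))) ` free_module V (N (Suc (i + j)))) (Suc q) D"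
      using 1 by (simp add: rim_def)
    show "coef (c l) 0 = 0" if "c \<in> free_module V (N (Suc (i + j)))" "gmap (B (i + j)) (N (Suc (i + j))) c = 0" for c l
      using m that unfolding minimal_def rker_def by blast
  qed
  then show ?case using r by (simp add: resol_def)
qed simp

lemma resol_generator:
  assumes r: "resol N \<tau> B" and nv: "\<not> kvanish (\<tau> 0) (rim N B 0) p D"
  shows "\<exists>l<N (Suc p). \<tau> (Suc p) l = D"
proof (rule ccontr)
  assume no: "\<not> ?thesis"
  have "kvanish (\<tau> p) (rim N B p) 0 D"
    unfolding rim_def using r no by (intro kvanish_image_0) (auto simp: resol_def)
  then show False using kvanish_rim_down[OF r, of 0 p 0 D] nv by simp
qed

text \<open>A Nakayama argument: vanishing writes the image of the l-th basis element as a
  combination of variables times elements of the image. Lifting these gives a relation with constant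
  term 1 at \<open>l\<close>, against minimality.\<close>

lemma resol_no_generator:
  assumes r: "resol N \<tau> B" and m: "minimal N B"
    and v: "kvanish (\<tau> 0) (rim N B 0) p D" and l: "l < N (Suc p)"
  shows "\<tau> (Suc p) l \<noteq> D"
proof
  assume D: "\<tau> (Suc p) l = D"
  let ?n = "N (Suc p)"
  have h: "homog (\<tau> p) D (B p l)" using r l D by (auto simp: resol_def)
  have kv: "kvanish (\<tau> p) (rim N B p) 0 D"
    using kvanish_rim_up[OF r m, of 0 0 p D] v by simp
  have sub: "submod V (rim N B p)" unfolding rim_def by (rule submod_gmap_image)
  have Bl: "B p l \<in> rim N B p"
    unfolding rim_def using gmap_unit[OF l, of "B p"] unit_free[OF l, of V] by force
  obtain y where y: "\<And>x. y x \<in> rim N B p" and Bly: "B p l = (\<lambda>m. \<Sum>x\<in>V. var x * y x m)"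
    using kvanish_0[OF kv submod_0[OF sub] Bl h] by blast
  have "\<forall>x. \<exists>c. c \<in> free_module V ?n \<and> y x = gmap (B p) ?n c"
    using y unfolding rim_def by blast
  then obtain c where c: "\<And>x. c x \<in> free_module V ?n" "\<And>x. y x = gmap (B p) ?n (c x)"
    by metis
  define u where "u = (\<lambda>m. if m = l then 1 else (0 :: ('v, 'a) mpoly))"
  define s where "s = (\<lambda>m. \<Sum>x\<in>V. var x * c x m)"
  have s: "s \<in> free_module V ?n"
    unfolding s_def using c(1) by (intro submod_sum[OF submod_free] submod_mult[OF submod_free]) auto
  have "gmap (B p) ?n s = (\<lambda>m. \<Sum>x\<in>V. var x * y x m)"
    unfolding s_def c(2) gmap_def sum_distrib_left sum_distrib_right
    by (subst sum.swap) (simp add: mult.assoc)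
  then have "gmap (B p) ?n (u - s) = 0"
    using gmap_unit[OF l, of "B p"] by (simp add: gmap_diff u_def Bly)
  moreover have "u - s \<in> free_module V ?n"
    using unit_free[OF l, of V] s unfolding u_def by (intro submod_diff[OF submod_free])
  ultimately have "u - s \<in> rker N B p" by (simp add: rker_def)
  then have "coef ((u - s) l) 0 = 0" using m unfolding minimal_def by blast
  moreover have "coef (s l) 0 = 0"
    by (simp add: s_def lookup_sum coef_var_mult)
  ultimately show False by (simp add: u_def lookup_minus)
qed

lemma resol_of_complex:
  fixes F :: "('v, 'k::field) free_complex"
  assumes "graded_free_resolution V J F"
  shows "resol (cx_rank F) (cx_twist F) (cx_map F)"
    and "rim (cx_rank F) (cx_map F) 0 = coord0 ` J"
proof -
  note F = assms[unfolded graded_free_resolution_def]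
  have e0: "coord0 p = 0 \<longleftrightarrow> p = 0" for p :: "('v, 'k) mpoly"
    by (auto simp: coord0_def fun_eq_iff)
  have map0: "gmap (cx_map F 0) (frank F 0) = (\<lambda>c. coord0 (aug_map F c))"
    by (simp add: cx_map_def gmap_coord0 fun_eq_iff)
  have mapS: "gmap (cx_map F (Suc i)) (frank F (Suc i)) = bdry_map F i" for i
    by (simp add: cx_map_def gmap_bdry fun_eq_iff)
  have rank: "cx_rank F (Suc i) = frank F i" for i by (simp add: cx_rank_def)
  show "rim (cx_rank F) (cx_map F) 0 = coord0 ` J"
  proof -
    have "J = aug_map F ` free_module V (frank F 0)" using F by blast
    then show ?thesis unfolding rim_def rank map0 by (simp add: image_image)
  qed
  have im0: "rim (cx_rank F) (cx_map F) (Suc i) = bdry_map F i ` free_module V (frank F (Suc i))" for i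
    unfolding rim_def rank mapS by simp
  have "rim (cx_rank F) (cx_map F) (Suc i) = rker (cx_rank F) (cx_map F) i" for i
  proof (cases i)
    case 0
    then show ?thesis using F unfolding im0 by (simp add: rker_def map0 rank e0)
  next
    case (Suc j)
    then show ?thesis using F unfolding im0 Suc rker_def rank mapS zero_fun_def by blast
  qed
  moreover have "homog (cx_twist F i) (cx_twist F (Suc i) l) (cx_map F i l)" if "l < cx_rank F (Suc i)" for i l
  proof (cases i)
    case 0
    then show ?thesis using F that by (auto simp: homog_def cx_twist_def cx_map_def cx_rank_def coord0_def)
  next
    case (Suc j)
    have l: "l < frank F (Suc j)" using that Suc by (simp add: cx_rank_def)
    have "\<forall>i. \<forall>l<frank F (Suc i). bdry F i l \<in> free_module V (frank F i) \<and>
        (\<forall>m<frank F i. \<forall>t\<in>supp (bdry F i l m). exp_degree t + twist F i m = twist F (Suc i) l)"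
      using F by (elim conjE)
    with l have bd: "bdry F j l \<in> free_module V (frank F j)"
      "\<forall>m<frank F j. \<forall>t\<in>supp (bdry F j l m). exp_degree t + twist F j m = twist F (Suc j) l"
      by auto
    have "exp_degree t + twist F j m = twist F (Suc j) l" if t: "t \<in> supp (bdry F j l m)" for m t
    proof -
      have "m < frank F j"
      proof (rule ccontr)
        assume "\<not> m < frank F j"
        then have "bdry F j l m = 0" using bd(1) by (auto simp: free_module_def)
        then show False using t by simp
      qed
      then show ?thesis using bd(2) t by blast
    qed
    then show ?thesis using Suc by (auto simp: homog_def cx_twist_def cx_map_def)
  qed
  ultimately show "resol (cx_rank F) (cx_twist F) (cx_map F)" by (simp add: resol_def)
qed

lemma minimal_of_complex:
  fixes F :: "('v, 'k::field) free_complex"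
  assumes "minimal_graded_free_resolution V J F"
  shows "minimal (cx_rank F) (cx_map F)"
  unfolding minimal_def
proof (intro allI ballI)
  have F: "graded_free_resolution V J F" using assms by (simp add: minimal_graded_free_resolution_def)
  fix i c l assume c: "c \<in> rker (cx_rank F) (cx_map F) i"
  then have "c \<in> rim (cx_rank F) (cx_map F) (Suc i)"
    using resol_of_complex(1)[OF F] by (simp add: resol_def)
  then obtain d where d: "c = gmap (bdry F i) (frank F (Suc i)) d"
    by (auto simp: rim_def cx_rank_def cx_map_def)
  show "coef (c l) 0 = 0"
  proof (cases "l < frank F i")
    case True
    then have "coef (bdry F i j l) 0 = 0" if "j < frank F (Suc i)" for j
      using assms that by (simp add: minimal_graded_free_resolution_def)
    then show ?thesis by (simp add: d gmap_def lookup_sum coef_mult_0)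
  next
    case False
    then show ?thesis using c by (auto simp: rker_def free_module_def cx_rank_def)
  qed
qed

text \<open>\<open>minimal_generators\<close> is iterated by dependent choice on triples of rank,
  twist and graded submodule. The invariant carries vanishing above degree \<open>n\<close> for all
  \<open>q\<close> at once, since passing to the next kernel consumes vanishing in homological
  degree one higher.\<close>

lemma minimal_resolution_exists:
  fixes J :: "('v, 'k::field) mpoly set"
  assumes J: "graded_submod V 1 (\<lambda>_. 0) (coord0 ` J)"
    and kv: "\<And>q D. D > n \<Longrightarrow> kvanish (\<lambda>_. 0) (coord0 ` J) q D"
  shows "\<exists>F. minimal_graded_free_resolution V J F"
proof -
  define P where "P i = (\<lambda>(N, \<tau>, Z :: (nat \<Rightarrow> ('v, 'k) mpoly) set).
    graded_submod V N \<tau> Z \<and> (\<forall>q. \<forall>D>n. kvanish \<tau> Z q D) \<and>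
    (i = (0::nat) \<longrightarrow> N = 1 \<and> \<tau> = (\<lambda>_. 0) \<and> Z = coord0 ` J))" for i
  define R where "R b = (\<lambda>(N :: nat, \<tau>, Z :: (nat \<Rightarrow> ('v, 'k) mpoly) set) (N', \<tau>', Z').
    (\<forall>l<N'. b l \<in> Z \<and> homog \<tau> (\<tau>' l) (b l)) \<and> gmap b N' ` free_module V N' = Z \<and>
    Z' = {c \<in> free_module V N'. gmap b N' c = 0} \<and> (\<forall>c\<in>Z'. \<forall>l. coef (c l) 0 = 0))" for b
  have "\<exists>s. \<forall>i. P i (s i) \<and> (\<exists>b. R b (s i) (s (Suc i)))"
  proof (rule dependent_nat_choice)
    show "\<exists>x. P 0 x" using J kv by (intro exI[of _ "(1, \<lambda>_. 0, coord0 ` J)"]) (simp add: P_def)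
    fix x i assume "P i x"
    obtain N \<tau> Z where x: "x = (N, \<tau>, Z)" by (cases x)
    have Z: "submod V Z" "Z \<subseteq> free_module V N" "\<And>c e. c \<in> Z \<Longrightarrow> hcomp \<tau> e c \<in> Z"
      "\<And>q D. D > n \<Longrightarrow> kvanish \<tau> Z q D"
      using \<open>P i x\<close> unfolding P_def x graded_submod_def by auto
    have "\<exists>N' \<tau>' b. (\<forall>l<N'. b l \<in> Z \<and> homog \<tau> (\<tau>' l) (b l)) \<and> gmap b N' ` free_module V N' = Z \<and>
        (\<forall>c\<in>free_module V N'. gmap b N' c = 0 \<longrightarrow> (\<forall>l. coef (c l) 0 = 0))"
      by (rule minimal_generators[where n = n and N = N]) (fact Z)+
    then obtain N' \<tau>' b where "\<forall>l<N'. b l \<in> Z \<and> homog \<tau> (\<tau>' l) (b l)"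
      and "gmap b N' ` free_module V N' = Z"
      and "\<forall>c\<in>free_module V N'. gmap b N' c = 0 \<longrightarrow> (\<forall>l. coef (c l) 0 = 0)"
      by (elim exE conjE)
    then have b: "\<And>l. l < N' \<Longrightarrow> b l \<in> Z" "\<And>l. l < N' \<Longrightarrow> homog \<tau> (\<tau>' l) (b l)"
      "gmap b N' ` free_module V N' = Z"
      "\<And>c l. c \<in> free_module V N' \<Longrightarrow> gmap b N' c = 0 \<Longrightarrow> coef (c l) 0 = 0"
      by blast+
    define Z' where "Z' = {c \<in> free_module V N'. gmap b N' c = 0}"
    have "R b x (N', \<tau>', Z')" using b by (simp add: R_def x Z'_def)
    moreover have "P (Suc i) (N', \<tau>', Z')"
    proof -
      have "hcomp \<tau>' e c \<in> Z'" if "c \<in> Z'" for c e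
      proof -
        have "gmap b N' (hcomp \<tau>' e c) = hcomp \<tau> e (gmap b N' c)"
          using gmap_hcomp[of N' \<tau> \<tau>' b 0 e c] b(2) by simp
        also have "\<dots> = 0" using that by (simp add: Z'_def hcomp_id)
        finally show ?thesis using that by (simp add: Z'_def hcomp_free)
      qed
      then have "graded_submod V N' \<tau>' Z'"
        using submod_gmap_kernel[of V N' b] by (auto simp: graded_submod_def Z'_def)
      moreover have "kvanish \<tau>' Z' q D" if "D > n" for q D
        unfolding Z'_def using Z(4)[OF that] b by (intro kvanish_kernel[where \<tau> = \<tau>]) auto
      ultimately show ?thesis by (simp add: P_def)
    qed
    ultimately show "\<exists>y. P (Suc i) y \<and> (\<exists>b. R b x y)" by blast
  qed
  then obtain s where s: "\<And>i. P i (s i)" "\<forall>i. \<exists>b. R b (s i) (s (Suc i))" by blast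
  define N where "N i = fst (s i)" for i
  define \<tau> where "\<tau> i = fst (snd (s i))" for i
  define Z where "Z i = snd (snd (s i))" for i
  have si: "s i = (N i, \<tau> i, Z i)" for i by (simp add: N_def \<tau>_def Z_def)
  from choice[OF s(2)] obtain B where B: "\<And>i. R (B i) (s i) (s (Suc i))" by blast
  have 0: "N 0 = 1" "\<tau> 0 = (\<lambda>_. 0)" "Z 0 = coord0 ` J"
    using s(1)[of 0] by (simp_all add: P_def si)
  have Zfree: "Z i \<subseteq> free_module V (N i)" for i
    using s(1)[of i] by (simp add: P_def si graded_submod_def)
  have BZ: "B i l \<in> Z i" "homog (\<tau> i) (\<tau> (Suc i) l) (B i l)" if "l < N (Suc i)" for i l
    using B[of i] that by (auto simp: R_def si)
  have im: "gmap (B i) (N (Suc i)) ` free_module V (N (Suc i)) = Z i" for i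
    using B[of i] by (simp add: R_def si)
  have ker: "Z (Suc i) = {c \<in> free_module V (N (Suc i)). gmap (B i) (N (Suc i)) c = 0}" for i
    using B[of i] by (simp add: R_def si)
  have mini: "coef (c l) 0 = 0" if "c \<in> Z (Suc i)" for c l i
    using B[of i] that by (auto simp: R_def si)
  \<comment> \<open>Index 0 of the chosen sequence is the ring, so all indices shift by one and
    \<open>B 0\<close>, read off its only coordinate, is the augmentation.\<close>
  define F where "F = \<lparr>frank = (\<lambda>i. N (Suc i)), twist = (\<lambda>i. \<tau> (Suc i)),
    aug = (\<lambda>l. B 0 l 0), bdry = (\<lambda>i. B (Suc i))\<rparr>"
  have B0: "B 0 l = coord0 (aug F l)" if "l < N (Suc 0)" for l
    using BZ(1)[OF that] Zfree[of 0] by (auto simp: F_def coord0_def free_module_def 0 fun_eq_iff)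
  have map0: "gmap (B 0) (N (Suc 0)) c = coord0 (aug_map F c)" for c
  proof -
    have "gmap (B 0) (N (Suc 0)) c = gmap (\<lambda>l. coord0 (aug F l)) (N (Suc 0)) c"
      unfolding gmap_def by (intro ext sum.cong refl) (simp add: B0)
    then show ?thesis using gmap_coord0[of F c] by (simp add: F_def)
  qed
  have mapS: "gmap (B (Suc i)) (N (Suc (Suc i))) = bdry_map F i" for i
    using gmap_bdry[of F i] by (simp add: F_def fun_eq_iff)
  have rank: "frank F i = N (Suc i)" for i by (simp add: F_def)
  have "graded_free_resolution V J F"
    unfolding graded_free_resolution_def
  proof (intro conjI allI impI ballI)
    fix l assume "l < frank F 0"
    then have l: "l < N (Suc 0)" by (simp add: rank)
    have fr: "B 0 l \<in> free_module V 1" using BZ(1)[OF l] Zfree[of 0] 0 by auto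
    then show "aug F l \<in> polys V" by (simp add: F_def free_module_def)
    show "exp_degree t = twist F 0 l" if "t \<in> supp (aug F l)" for t
      using BZ(2)[OF l] that by (force simp: F_def homog_def 0)
  next
    fix i l assume "l < frank F (Suc i)"
    then have l: "l < N (Suc (Suc i))" by (simp add: rank)
    show "bdry F i l \<in> free_module V (frank F i)" using BZ(1)[OF l] Zfree by (auto simp: F_def)
    show "exp_degree t + twist F i m = twist F (Suc i) l" if "t \<in> supp (bdry F i l m)" for m t
      using BZ(2)[OF l] that by (simp add: F_def homog_def)
  next
    have "coord0 ` (aug_map F ` free_module V (frank F 0)) = coord0 ` J"
      using im[of 0] by (simp add: map0 rank 0 image_image)
    moreover have "inj (coord0 :: ('v, 'k) mpoly \<Rightarrow> _)"
      by (rule injI) (metis coord0_def)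
    ultimately show "aug_map F ` free_module V (frank F 0) = J"
      by (simp add: inj_image_eq_iff)
  next
    have e0: "coord0 p = 0 \<longleftrightarrow> p = 0" for p :: "('v, 'k) mpoly"
      by (auto simp: coord0_def fun_eq_iff)
    show "bdry_map F 0 ` free_module V (frank F 1) = {c \<in> free_module V (frank F 0). aug_map F c = 0}"
      using im[of "Suc 0"] ker[of 0] by (simp add: mapS map0 rank e0)
  next
    fix i
    show "bdry_map F (Suc i) ` free_module V (frank F (Suc (Suc i))) =
      {c \<in> free_module V (frank F (Suc i)). bdry_map F i c = (\<lambda>_. 0)}"
      using im[of "Suc (Suc i)"] ker[of "Suc i"] by (simp add: mapS rank zero_fun_def)
  qed
  moreover have "coef (bdry F i l m) 0 = 0" if "l < frank F (Suc i)" for i l m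
    using BZ(1)[of l "Suc i"] mini[of "B (Suc i) l" i m] that by (simp add: F_def)
  ultimately show ?thesis unfolding minimal_graded_free_resolution_def by blast
qed

text \<open>Existence makes the resolution chosen by \<open>SOME\<close> a minimal one. The
  right-hand side mentions no resolution, so the choice leaves no trace.\<close>

lemma betti_nonzero_iff:
  fixes J :: "('v, 'k::field) mpoly set"
  assumes J: "graded_submod V 1 (\<lambda>_. 0) (coord0 ` J)"
    and kv: "\<And>q D. D > n \<Longrightarrow> kvanish (\<lambda>_. 0) (coord0 ` J) q D"
  shows "betti V J i j \<noteq> 0 \<longleftrightarrow> \<not> kvanish (\<lambda>_. 0) (coord0 ` J) i j"
proof -
  define F where "F = (SOME F. minimal_graded_free_resolution V J F)"
  have min: "minimal_graded_free_resolution V J F"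
    unfolding F_def using minimal_resolution_exists[OF assms] by (rule someI_ex)
  then have F: "graded_free_resolution V J F" by (simp add: minimal_graded_free_resolution_def)
  note r = resol_of_complex[OF F]
  have t0: "cx_twist F 0 = (\<lambda>_. 0)" by (simp add: cx_twist_def)
  have "betti V J i j \<noteq> 0 \<longleftrightarrow> (\<exists>l<frank F i. twist F i l = j)"
    by (auto simp: betti_def F_def[symmetric] Let_def)
  also have "\<dots> \<longleftrightarrow> \<not> kvanish (\<lambda>_. 0) (coord0 ` J) i j"
    using resol_generator[OF r(1), of i j] resol_no_generator[OF r(1) minimal_of_complex[OF min], of i j]
    unfolding r(2) t0 by (auto simp: cx_rank_def cx_twist_def)
  finally show ?thesis .
qed

end

section \<open>Square-free monomial ideals\<close>

text \<open>Membership in a square-free monomial ideal depends only on the supports of the terms, so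
  a family \<open>U\<close> of supports encodes it; it is an ideal if \<open>U\<close> is closed
  under supersets within \<open>V\<close>.\<close>

definition sqideal :: "'v set \<Rightarrow> 'v set set \<Rightarrow> ('v, 'k::field) mpoly set" where
  "sqideal V U = {p \<in> polys V. \<forall>t\<in>supp p. supp t \<in> U}"

definition upset :: "'v set \<Rightarrow> 'v set set \<Rightarrow> bool" where
  "upset V U \<longleftrightarrow> (\<forall>A\<in>U. \<forall>B. A \<subseteq> B \<and> B \<subseteq> V \<longrightarrow> B \<in> U)"

lemma sqideal_0: "0 \<in> sqideal V U"
  by (simp add: sqideal_def)

lemma sqideal_add: "p \<in> sqideal V U \<Longrightarrow> q \<in> sqideal V U \<Longrightarrow> p + q \<in> sqideal V U"
  using keys_add[of p q] by (auto simp: sqideal_def)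

lemma sqideal_mult:
  assumes U: "upset V U" and p: "p \<in> polys V" and q: "q \<in> sqideal V U"
  shows "p * q \<in> sqideal V U"
proof -
  have pq: "p * q \<in> polys V" using p q by (auto simp: sqideal_def)
  have "supp t \<in> U" if t: "t \<in> supp (p * q)" for t
  proof -
    obtain r s where rs: "t = r + s" "s \<in> supp q" using keys_mult[of p q] t by auto
    have "supp t \<subseteq> V" using pq t by (auto simp: polys_def)
    moreover have "supp s \<in> U" using q rs by (auto simp: sqideal_def)
    moreover have "supp s \<subseteq> supp t" by (simp add: rs supp_add_nat)
    ultimately show ?thesis using U unfolding upset_def by blast
  qed
  then show ?thesis using pq by (simp add: sqideal_def)
qed

lemma monom_in_sqideal: "finite W \<Longrightarrow> W \<subseteq> V \<Longrightarrow> W \<in> U \<Longrightarrow> monom (sqexp W) c \<in> sqideal V U"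
  by (auto simp: sqideal_def polys_def supp_sqexp)

lemma graded_submod_sqideal:
  assumes U: "upset V U"
  shows "graded_submod V 1 (\<lambda>_. 0) (coord0 ` (sqideal V U :: ('v, 'k::field) mpoly set))"
    (is "graded_submod _ _ _ ?Z")
  unfolding graded_submod_def submod_def
proof (intro conjI ballI allI)
  show "0 \<in> ?Z"
    using sqideal_0 by (intro image_eqI[of _ _ 0]) (auto simp: coord0_def fun_eq_iff)
  show "c + d \<in> ?Z" if cd: "c \<in> ?Z" "d \<in> ?Z" for c d
  proof -
    obtain p q where "c = coord0 p" "d = coord0 q" "p \<in> sqideal V U" "q \<in> sqideal V U" using cd by blast
    then show ?thesis
      by (intro image_eqI[of _ _ "p + q"]) (auto simp: coord0_def fun_eq_iff intro: sqideal_add)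
  qed
  show "(\<lambda>l. p * c l) \<in> ?Z" if pc: "p \<in> polys V" "c \<in> ?Z" for p c
  proof -
    obtain q where "c = coord0 q" "q \<in> sqideal V U" using pc(2) by blast
    then show ?thesis using pc(1)
      by (intro image_eqI[of _ _ "p * q"]) (auto simp: coord0_def fun_eq_iff intro: sqideal_mult[OF U])
  qed
  show "?Z \<subseteq> free_module V 1" by (auto simp: free_module_def coord0_def sqideal_def)
  show "hcomp (\<lambda>_. 0) e c \<in> ?Z" if c: "c \<in> ?Z" for c e
  proof -
    obtain q where q: "c = coord0 q" "q \<in> sqideal V U" using c by blast
    have "hcomp (\<lambda>_. 0) e c = coord0 (pfilter (\<lambda>t. exp_degree t + 0 = e) q)"
      by (auto simp: q(1) hcomp_def coord0_def fun_eq_iff)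
    moreover have "pfilter (\<lambda>t. exp_degree t + 0 = e) q \<in> sqideal V U"
      using q(2) by (auto simp: sqideal_def polys_pfilter supp_pfilter)
    ultimately show ?thesis by blast
  qed
qed

lemma exists_exponent_ge_2:
  assumes "finite V" "supp a \<subseteq> V" "card V < exp_degree a"
  shows "\<exists>x. 2 \<le> coef a x"
proof (rule ccontr)
  assume "\<not> ?thesis"
  then have "coef a x \<le> 1" for x by (simp add: not_le) (metis less_2_cases_iff le_eq_less_or_eq One_nat_def less_Suc_eq_le)
  then have "(\<Sum>x\<in>V. coef a x) \<le> (\<Sum>x\<in>V. 1)" by (intro sum_mono)
  then show False using assms by (simp add: exp_degree_superset)
qed

context koszul
begin

text \<open>In total degree above \<open>card V\<close> every multidegree has an exponent at least 2; dividing by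
  that variable does not change the support, so the variable is the apex of a cone.\<close>

lemma kvanish_sqideal:
  assumes D: "card V < D"
  shows "kvanish (\<lambda>_. 0) (coord0 ` (sqideal V U :: ('v, 'k::field) mpoly set)) q D"
  unfolding kvanish_def
proof (intro allI impI, elim conjE)
  let ?Z = "coord0 ` (sqideal V U :: ('v, 'k) mpoly set)"
  fix w assume w: "kchain (\<lambda>_. 0) ?Z q D w" and cyc: "\<forall>S. kd w S = 0"
  have wS: "w S \<in> ?Z" "homog (\<lambda>l. 0 + card S) D (w S)" "w S \<noteq> 0 \<Longrightarrow> S \<subseteq> V \<and> card S = q" for S
    using w unfolding kchain_def by blast+
  have w0: "w S = coord0 (w S 0)" "w S 0 \<in> sqideal V U" for S
    using wS(1)[of S] by (auto simp: coord0_def)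
  define \<xi> where "\<xi> a = (SOME x. 2 \<le> coef a x)" for a :: "'v \<Rightarrow>\<^sub>0 nat"
  have \<xi>: "2 \<le> coef (t + sqexp S) (\<xi> (t + sqexp S))" if t: "t \<in> supp (w S 0)" for S t
  proof -
    have "w S \<noteq> 0" using t by auto
    then have S: "S \<subseteq> V" using wS(3) by blast
    then have finS: "finite S" using finite_V by (rule finite_subset)
    have "supp t \<subseteq> V" using t w0(2)[of S] by (auto simp: sqideal_def polys_def)
    then have 1: "supp (t + sqexp S) \<subseteq> V" using S finS by (simp add: supp_add_nat supp_sqexp)
    have "exp_degree t + (0 + card S) = D" using wS(2) t unfolding homog_def by blast
    then have "card V < exp_degree (t + sqexp S)" using D finS by (simp add: exp_degree_add exp_degree_sqexp)
    from exists_exponent_ge_2[OF finite_V 1 this] show ?thesis unfolding \<xi>_def by (rule someI_ex)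
  qed
  have 1: "S \<subseteq> V" if "w S 0 \<noteq> 0" for S
  proof -
    have "w S \<noteq> 0" using that by auto
    then show ?thesis using wS(3) by blast
  qed
  have 2: "w S 0 \<in> polys V" for S using w0(2)[of S] by (simp add: sqideal_def)
  have 3: "kd1 (\<lambda>S. w S 0) S = 0" for S using cyc by (simp add: kd_def fun_eq_iff)
  have 4: "\<xi> (t + sqexp S) \<in> supp (t + sqexp S)" if "t \<in> supp (w S 0)" for S t
    using \<xi>[OF that] by (auto simp: in_keys_iff)
  obtain h where h: "\<forall>S. kd1 h S = w S 0" "\<forall>S. \<forall>t\<in>supp (h S). S \<subseteq> V \<and>
      (\<exists>x\<in>S. x = \<xi> (t + sqexp S) \<and> t + monom x 1 \<in> supp (w (S - {x}) 0))"
    using cone[of "\<lambda>S. w S 0" \<xi>, OF 1 2 3 4] by blast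
  have hS: "supp t \<in> U \<and> supp t \<subseteq> V \<and> exp_degree t + card S = D \<and> S \<subseteq> V \<and> card S = Suc q"
    if t: "t \<in> supp (h S)" for S t
  proof -
    from h(2) t obtain x where SV: "S \<subseteq> V" and x: "x \<in> S" "x = \<xi> (t + sqexp S)"
      and u: "t + monom x 1 \<in> supp (w (S - {x}) 0)" by blast
    have finS: "finite S" using SV finite_V by (rule finite_subset)
    have a: "(t + monom x 1) + sqexp (S - {x}) = t + sqexp S"
      using sqexp_remove[OF finS x(1)] by (simp add: add.assoc)
    \<comment> \<open>The basis element e_S accounts for just 1 of this exponent, so
      \<open>x\<close> still divides the monomial with exponent \<open>t\<close>.\<close>
    have "2 \<le> coef (t + sqexp S) x" using \<xi>[OF u] unfolding a x(2)[symmetric] .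
    then have "x \<in> supp t" using finS x(1) by (simp add: lookup_add coef_sqexp in_keys_iff)
    then have supp: "supp (t + monom x 1) = supp t" by (auto simp: supp_add_nat)
    have "w (S - {x}) \<noteq> 0" using u by auto
    then have "card (S - {x}) = q" using wS(3) by blast
    then have card: "card S = Suc q" using finS x(1) by (metis card_Suc_Diff1)
    have "exp_degree (t + monom x 1) + (0 + card (S - {x})) = D"
      using wS(2) u unfolding homog_def by blast
    then have "exp_degree t + card S = D"
      using card \<open>card (S - {x}) = q\<close> exp_degree_monom[of x] by (simp add: exp_degree_add)
    moreover have "supp (t + monom x 1) \<in> U \<and> supp (t + monom x 1) \<subseteq> V"
      using w0(2)[of "S - {x}"] u by (auto simp: sqideal_def polys_def)
    ultimately show ?thesis using SV card unfolding supp by blast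
  qed
  have "kchain (\<lambda>_. 0) ?Z (Suc q) D (\<lambda>S. coord0 (h S))"
    unfolding kchain_def
  proof (intro allI conjI)
    fix S
    have "h S \<in> sqideal V U" using hS by (auto simp: sqideal_def polys_def)
    then show "coord0 (h S) \<in> ?Z" by blast
    show "homog (\<lambda>l. 0 + card S) D (coord0 (h S))"
      unfolding homog_def
    proof (intro allI ballI)
      fix l t assume "t \<in> supp (coord0 (h S) l)"
      then have "t \<in> supp (h S)" by (auto simp: coord0_def split: if_splits)
      then show "exp_degree t + (0 + card S) = D" using hS[of t S] by simp
    qed
    show "coord0 (h S) \<noteq> 0 \<longrightarrow> S \<subseteq> V \<and> card S = Suc q"
    proof
      assume "coord0 (h S) \<noteq> 0"
      then have "h S \<noteq> 0" by (auto simp: coord0_def fun_eq_iff split: if_splits)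
      then obtain t where "t \<in> supp (h S)" using supp_empty_iff by blast
      then show "S \<subseteq> V \<and> card S = Suc q" using hS by blast
    qed
  qed
  moreover have "kd (\<lambda>S. coord0 (h S)) S = w S" for S
  proof
    fix l
    have "w S l = coord0 (w S 0) l" using w0(1)[of S] by simp
    then show "kd (\<lambda>S. coord0 (h S)) S l = w S l"
      using h(1) by (cases "l = 0") (simp_all add: kd_def coord0_def kd1_def)
  qed
  ultimately show "\<exists>h. kchain (\<lambda>_. 0) ?Z (Suc q) D h \<and> (\<forall>S. kd h S = w S)" by blast
qed

end

section \<open>The square-free power of an edge ideal as a square-free monomial ideal\<close>

lemma cring_poly_ring: "cring (poly_ring V :: ('v, 'k::field) mpoly ring)"
proof (rule cringI)
  show "abelian_group (poly_ring V :: ('v, 'k) mpoly ring)"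
  proof (rule abelian_groupI)
    show "\<exists>q\<in>carrier (poly_ring V). q \<oplus>\<^bsub>poly_ring V\<^esub> p = \<zero>\<^bsub>poly_ring V\<^esub>"
      if "p \<in> carrier (poly_ring V)" for p :: "('v, 'k) mpoly"
      using that by (intro bexI[of _ "- p"]) (auto simp: poly_ring_def)
  qed (auto simp: poly_ring_def algebra_simps)
  show "comm_monoid (poly_ring V :: ('v, 'k) mpoly ring)"
    by (rule comm_monoidI) (auto simp: poly_ring_def algebra_simps)
qed (auto simp: poly_ring_def algebra_simps)

lemma ideal_sqideal:
  assumes "upset V U"
  shows "ideal (sqideal V U :: ('v, 'k::field) mpoly set) (poly_ring V)"
proof (rule idealI)
  interpret R: cring "poly_ring V :: ('v, 'k) mpoly ring" by (rule cring_poly_ring)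
  show "ring (poly_ring V :: ('v, 'k) mpoly ring)" by (rule R.ring_axioms)
  show "subgroup (sqideal V U :: ('v, 'k) mpoly set) (add_monoid (poly_ring V))"
  proof (rule R.add.subgroupI)
    show "(sqideal V U :: ('v, 'k) mpoly set) \<subseteq> carrier (poly_ring V)"
      by (auto simp: sqideal_def poly_ring_def)
    show "(sqideal V U :: ('v, 'k) mpoly set) \<noteq> {}" using sqideal_0 by blast
    show "p \<oplus>\<^bsub>poly_ring V\<^esub> q \<in> sqideal V U" if "p \<in> sqideal V U" "q \<in> sqideal V U" for p q :: "('v, 'k) mpoly"
      using that by (simp add: poly_ring_def sqideal_add)
    show "\<ominus>\<^bsub>poly_ring V\<^esub> p \<in> sqideal V U" if p: "p \<in> sqideal V U" for p :: "('v, 'k) mpoly"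
    proof -
      have "p \<in> polys V" using p by (simp add: sqideal_def)
      then have "\<ominus>\<^bsub>poly_ring V\<^esub> p = - p" by (intro R.minus_equality) (auto simp: poly_ring_def)
      then show ?thesis using p by (simp add: sqideal_def supp_uminus)
    qed
  qed
  fix a x :: "('v, 'k) mpoly" assume "a \<in> sqideal V U" "x \<in> carrier (poly_ring V)"
  then have "x * a \<in> sqideal V U"
    by (intro sqideal_mult[OF assms]) (auto simp: poly_ring_def)
  then show "x \<otimes>\<^bsub>poly_ring V\<^esub> a \<in> sqideal V U" "a \<otimes>\<^bsub>poly_ring V\<^esub> x \<in> sqideal V U"
    by (simp_all add: poly_ring_def mult.commute)
qed

text \<open>For the inclusion from right to left: a polynomial is the sum of its terms, and each
  term is divisible by the generator of some \<open>B\<close> inside its support.\<close>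

lemma genideal_sqfree_monoms:
  assumes V: "finite V" and A: "A \<subseteq> Pow V"
  shows "genideal (poly_ring V) (sqfree_monom ` A :: ('v, 'k::field) mpoly set)
    = sqideal V {W. W \<subseteq> V \<and> (\<exists>B\<in>A. B \<subseteq> W)}" (is "?L = sqideal V ?U")
proof
  interpret R: cring "poly_ring V :: ('v, 'k) mpoly ring" by (rule cring_poly_ring)
  have fin: "finite B" "B \<subseteq> V" if "B \<in> A" for B
    using that A V by (auto intro: finite_subset)
  have "upset V ?U" by (auto simp: upset_def)
  moreover have "sqfree_monom ` A \<subseteq> (sqideal V ?U :: ('v, 'k) mpoly set)"
    using fin by (auto simp: sqfree_monom_eq intro!: monom_in_sqideal)
  ultimately show "?L \<subseteq> sqideal V ?U" by (intro R.genideal_minimal ideal_sqideal)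
  have gen: "sqfree_monom ` A \<subseteq> carrier (poly_ring V :: ('v, 'k) mpoly ring)"
    using fin by (auto simp: poly_ring_def polys_sqfree_monom)
  interpret L: ideal ?L "poly_ring V" by (rule R.genideal_ideal[OF gen])
  have closed: "p + q \<in> ?L" if "p \<in> ?L" "q \<in> ?L" for p q
    using L.a_closed[OF that] by (simp add: poly_ring_def)
  have zero: "0 \<in> ?L" using L.zero_closed by (simp add: poly_ring_def)
  show "sqideal V ?U \<subseteq> ?L"
  proof
    fix p :: "('v, 'k) mpoly" assume p: "p \<in> sqideal V ?U"
    have "monom t (coef p t) \<in> ?L" if t: "t \<in> supp p" for t
    proof -
      obtain B where B: "B \<in> A" "B \<subseteq> supp t" using p t by (auto simp: sqideal_def)
      define u where "u = t - sqexp B"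
      have tu: "t = u + sqexp B"
        using B fin by (intro poly_mapping_eqI)
          (auto simp: u_def lookup_add lookup_minus coef_sqexp in_keys_iff subset_iff)
      have "supp t \<subseteq> V" using p t by (auto simp: sqideal_def)
      then have "monom u (coef p t) \<in> carrier (poly_ring V)"
        by (auto simp: poly_ring_def polys_def tu supp_add_nat)
      moreover have "sqfree_monom B \<in> ?L" using R.genideal_self[OF gen] B(1) by blast
      ultimately have "monom u (coef p t) * sqfree_monom B \<in> ?L"
        using L.I_l_closed by (fastforce simp: poly_ring_def)
      then show ?thesis using fin B(1) by (simp add: sqfree_monom_eq mult_single tu)
    qed
    then have "sum (\<lambda>t. monom t (coef p t)) T \<in> ?L" if "T \<subseteq> supp p" for T
      using that by (induction T rule: infinite_finite_induct) (auto simp: zero closed)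
    then show "p \<in> ?L" using mpoly_eq_sum_monom[of p] by (metis order_refl)
  qed
qed

text \<open>Divisibility by a product of \<open>k\<close> edges, repetitions allowed: the property
  shared by all terms of elements of the k-th power of the edge ideal.\<close>

fun edge_divides :: "'v set set \<Rightarrow> nat \<Rightarrow> ('v \<Rightarrow>\<^sub>0 nat) \<Rightarrow> bool" where
  "edge_divides E 0 t \<longleftrightarrow> True"
| "edge_divides E (Suc k) t \<longleftrightarrow> (\<exists>e\<in>E. \<exists>u. t = sqexp e + u \<and> edge_divides E k u)"

lemma edge_divides_add: "edge_divides E k t \<Longrightarrow> edge_divides E k (s + t)"
proof (cases k)
  case (Suc j)
  assume "edge_divides E k t"
  then obtain e u where "e \<in> E" "t = sqexp e + u" "edge_divides E j u" using Suc by auto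
  moreover have "edge_divides E j u \<Longrightarrow> edge_divides E j (s + u)"
    by (induction j arbitrary: u) (auto, metis add.left_commute)
  ultimately show ?thesis using Suc by (auto simp: add.left_commute intro!: bexI[of _ e] exI[of _ "s + u"])
qed simp

text \<open>Exponents at most 1 leave no room for overlaps: dividing by an edge \<open>e\<close>
  turns \<open>sqexp W\<close> into \<open>sqexp (W - e)\<close>. As edges are nonempty, disjoint
  edges are distinct, so exactly \<open>k\<close> are found.\<close>

lemma edge_divides_sqexp:
  assumes "edge_divides E k (sqexp W)" "finite W" "\<And>e. e \<in> E \<Longrightarrow> finite e \<and> e \<noteq> {}"
  shows "\<exists>N\<subseteq>E. finite N \<and> card N = k \<and> pairwise disjnt N \<and> \<Union>N \<subseteq> W"
  using assms(1,2)
proof (induction k arbitrary: W)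
  case 0
  then show ?case by (intro exI[of _ "{}"]) auto
next
  case (Suc k)
  then obtain e u where e: "e \<in> E" "sqexp W = sqexp e + u" "edge_divides E k u" by auto
  have fe: "finite e" "e \<noteq> {}" using assms(3) e(1) by auto
  have "supp (sqexp W) = supp (sqexp e) \<union> supp u" using e(2) by (simp add: supp_add_nat)
  then have eW: "e \<subseteq> W" using fe Suc.prems by (auto simp: supp_sqexp)
  have "u = sqexp (W - e)"
  proof (rule poly_mapping_eqI)
    fix x
    have "coef (sqexp W) x = coef (sqexp e) x + coef u x" using e(2) by (simp add: lookup_add)
    then show "coef u x = coef (sqexp (W - e)) x"
      using fe Suc.prems eW by (auto simp: coef_sqexp split: if_splits)
  qed
  then obtain N where N: "N \<subseteq> E" "finite N" "card N = k" "pairwise disjnt N" "\<Union>N \<subseteq> W - e"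
    using Suc.IH[of "W - e"] e(3) Suc.prems by auto
  have "e \<notin> N" using N(5) fe by blast
  moreover have "pairwise disjnt (insert e N)"
    using N(4,5) by (auto simp: pairwise_insert disjnt_def)
  ultimately show ?case
    using N e(1) eW by (intro exI[of _ "insert e N"]) auto
qed

definition matched_sets :: "'v hgraph \<Rightarrow> nat \<Rightarrow> 'v set set" where
  "matched_sets H k = {W. W \<subseteq> verts H \<and> (\<exists>N. matching H N \<and> card N = k \<and> \<Union>N \<subseteq> W)}"

lemma upset_matched_sets: "upset (verts H) (matched_sets H k)"
  unfolding upset_def matched_sets_def by blast

lemma ideal_power_Suc:
  "ideal_power V I (Suc k) = ideal_prod (poly_ring V) I (ideal_power V I k)"
  by (simp add: ideal_power_def)

text \<open>A square-free monomial in the power is divisible by \<open>k\<close> edges, which must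
  be disjoint (\<open>down\<close>); conversely the product over a matching of size \<open>k\<close>
  is a product of \<open>k\<close> generators (\<open>up\<close>).\<close>

lemma sqfree_power_edge_ideal:
  assumes H: "hypergraph H"
  shows "sqfree_power (verts H) (edge_ideal H :: ('v, 'k::field) mpoly set) k
    = sqideal (verts H) (matched_sets H k)"
proof -
  define V where "V = verts H"
  define E where "E = edges H"
  define I where "I = (edge_ideal H :: ('v, 'k) mpoly set)"
  have V: "finite V" and E: "\<And>e. e \<in> E \<Longrightarrow> e \<subseteq> V \<and> e \<noteq> {} \<and> finite e" and EP: "E \<subseteq> Pow V"
    using H by (auto simp: hypergraph_def V_def E_def intro: finite_subset)
  have finE: "finite E" using EP V by (meson finite_Pow_iff finite_subset)
  have I: "I = sqideal V {W. W \<subseteq> V \<and> (\<exists>B\<in>E. B \<subseteq> W)}"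
    unfolding I_def edge_ideal_def V_def[symmetric] E_def[symmetric] by (rule genideal_sqfree_monoms[OF V EP])
  have down: "\<forall>t\<in>supp p. edge_divides E k t" if "p \<in> ideal_power V I k" for p k
    using that
  proof (induction k arbitrary: p)
    case (Suc k)
    from Suc.prems have "p \<in> ideal_prod (poly_ring V) I (ideal_power V I k)" by (simp add: ideal_power_Suc)
    then show ?case
    proof (induction rule: ideal_prod.induct)
      case (prod i j)
      show ?case
      proof
        fix t assume "t \<in> supp (i \<otimes>\<^bsub>poly_ring V\<^esub> j)"
        then obtain r s where rs: "t = r + s" "r \<in> supp i" "s \<in> supp j"
          using keys_mult[of i j] by (auto simp: poly_ring_def)
        obtain e where e: "e \<in> E" "e \<subseteq> supp r" using prod(1) rs(2) by (auto simp: I sqideal_def)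
        have "r = sqexp e + (r - sqexp e)"
          using e E by (intro poly_mapping_eqI)
            (auto simp: lookup_add lookup_minus coef_sqexp in_keys_iff subset_iff)
        then have "t = sqexp e + ((r - sqexp e) + s)" using rs(1) by (metis add.assoc)
        moreover have "edge_divides E k ((r - sqexp e) + s)"
          using Suc.IH[OF prod(2)] rs(3) by (intro edge_divides_add) blast
        ultimately show "edge_divides E (Suc k) t" using e(1) by auto
      qed
    next
      case (sum a b)
      then show ?case using keys_add[of a b] by (fastforce simp: poly_ring_def simp del: edge_divides.simps)
    qed
  qed simp
  have up: "sqfree_monom (\<Union>N) \<in> ideal_power V I (card N)" if "finite N" "N \<subseteq> E" "pairwise disjnt N" for N
    using that
  proof (induction N rule: finite_induct)
    case empty
    then show ?case by (simp add: ideal_power_def sqfree_monom_def)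
  next
    case (insert e N)
    have fe: "finite e" "e \<subseteq> V" "e \<in> E" using insert.prems E by auto
    have fN: "finite (\<Union>N)" using insert E by auto
    have dis: "e \<inter> \<Union>N = {}"
      using insert.prems(2) insert.hyps(2) by (auto simp: pairwise_insert disjnt_def)
    have "sqfree_monom e \<in> I"
      unfolding I using fe by (auto simp: sqfree_monom_eq intro!: monom_in_sqideal)
    moreover have "sqfree_monom (\<Union>N) \<in> ideal_power V I (card N)"
      using insert.IH insert.prems by (auto simp: pairwise_insert)
    ultimately have "sqfree_monom e \<otimes>\<^bsub>poly_ring V\<^esub> sqfree_monom (\<Union>N) \<in> ideal_power V I (Suc (card N))"
      unfolding ideal_power_Suc by (rule ideal_prod.prod)
    moreover have "(sqfree_monom (\<Union>(insert e N)) :: ('v, 'k) mpoly) = sqfree_monom e * sqfree_monom (\<Union>N)"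
      unfolding sqfree_monom_def using fe fN dis by (simp add: prod.union_disjoint)
    ultimately show ?case using insert.hyps by (simp add: poly_ring_def)
  qed
  define A where "A = {W. W \<subseteq> V \<and> (sqfree_monom W :: ('v, 'k) mpoly) \<in> ideal_power V I k}"
  have "sqfree_power V I k = genideal (poly_ring V) (sqfree_monom ` A)"
    unfolding sqfree_power_def A_def by (rule arg_cong[of _ _ "genideal _"]) auto
  also have "\<dots> = sqideal V {W. W \<subseteq> V \<and> (\<exists>B\<in>A. B \<subseteq> W)}"
    by (rule genideal_sqfree_monoms[OF V]) (auto simp: A_def)
  also have "{W. W \<subseteq> V \<and> (\<exists>B\<in>A. B \<subseteq> W)} = matched_sets H k"
  proof (intro Set.set_eqI iffI)
    fix W assume "W \<in> {W. W \<subseteq> V \<and> (\<exists>B\<in>A. B \<subseteq> W)}"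
    then obtain B where B: "B \<in> A" "B \<subseteq> W" "W \<subseteq> V" by blast
    then have finB: "finite B" using V by (meson finite_subset)
    have "edge_divides E k (sqexp B)"
      using down[of "sqfree_monom B" k] B(1) finB by (simp add: A_def sqfree_monom_eq)
    from edge_divides_sqexp[OF this finB] E obtain N
      where "N \<subseteq> E" "card N = k" "pairwise disjnt N" "\<Union>N \<subseteq> B" by blast
    then show "W \<in> matched_sets H k"
      using B by (auto simp: matched_sets_def matching_def E_def V_def intro!: exI[of _ N])
  next
    fix W assume "W \<in> matched_sets H k"
    then obtain N where N: "W \<subseteq> V" "N \<subseteq> E" "pairwise disjnt N" "card N = k" "\<Union>N \<subseteq> W"
      by (auto simp: matched_sets_def matching_def E_def V_def)
    have "sqfree_monom (\<Union>N) \<in> ideal_power V I k"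
      using up[of N] N finE finite_subset by blast
    then have "\<Union>N \<in> A" using N by (auto simp: A_def)
    then show "W \<in> {W. W \<subseteq> V \<and> (\<exists>B\<in>A. B \<subseteq> W)}" using N by blast
  qed
  finally show ?thesis by (simp add: V_def I_def)
qed

section \<open>A Koszul cycle that is not a boundary\<close>

text \<open>\<open>P\<close> selects one element of each pair, so that terms really cancel.
  Reindexing along \<sigma> alone would show only that twice the sum is 0.\<close>

lemma sum_involution:
  fixes a :: "'b \<Rightarrow> 'a::ab_group_add"
  assumes A: "finite A" "\<And>x. x \<in> A \<Longrightarrow> \<sigma> x \<in> A" "\<And>x. x \<in> A \<Longrightarrow> \<sigma> (\<sigma> x) = x"
    and a: "\<And>x. x \<in> A \<Longrightarrow> a (\<sigma> x) = - a x"
    and P: "\<And>x. x \<in> A \<Longrightarrow> P (\<sigma> x) \<longleftrightarrow> \<not> P x"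
  shows "sum a A = 0"
proof -
  have "sum a {x \<in> A. \<not> P x} = (\<Sum>x\<in>{x \<in> A. P x}. - a x)"
    by (rule sum.reindex_bij_witness[of _ \<sigma> \<sigma>]) (use A P a in auto)
  moreover have "sum a A = sum a {x \<in> A. P x} + sum a {x \<in> A. \<not> P x}"
    using A(1) by (subst sum.union_disjoint[symmetric]) (auto intro: sum.cong)
  ultimately show ?thesis by (simp add: sum_negf)
qed

context koszul
begin

text \<open>The pushforward of a cycle along \<open>\<pi>\<close> is a cycle.  As \<open>f\<close> orders the vertices block by block,
  \<open>\<pi>\<close> preserves the order on every transversal, so no signs of permutations enter; the two vertices
  of a face \<open>S\<close> with the same image contribute to the boundary with opposite signs.\<close>

lemma cycle_transversal:
  fixes g :: "'v set \<Rightarrow> 'a::comm_ring_1" and \<pi> :: "'v \<Rightarrow> nat"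
  assumes W: "W \<subseteq> V" and ord: "\<And>x y. x \<in> W \<Longrightarrow> y \<in> W \<Longrightarrow> \<pi> x < \<pi> y \<Longrightarrow> f x < f y"
    and cyc: "\<And>S. S \<subseteq> W \<Longrightarrow> (\<Sum>y\<in>W - S. ksgn f y S * g (insert y S)) = 0"
    and T: "T \<subseteq> W" "T \<noteq> {}" "inj_on \<pi> T"
    and g0: "\<And>S. S \<subseteq> W \<Longrightarrow> inj_on \<pi> S \<Longrightarrow> S \<noteq> T \<Longrightarrow> g S = 0"
  shows "g T = 0"
proof -
  have finW: "finite W" using W finite_V by (rule finite_subset)
  obtain v where v: "v \<in> T" using T(2) by blast
  define T0 where "T0 = T - {v}"
  have T0: "T = insert v T0" "v \<notin> T0" "T0 \<subseteq> W" "v \<in> W" using v T by (auto simp: T0_def)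
  \<comment> \<open>The faces with the same image as the facet \<open>T0\<close> of
    \<open>T\<close>. Adding the cycle conditions over all of them yields the coefficient of this
    image in the boundary of the pushforward.\<close>
  define \<A> where "\<A> = {S. S \<subseteq> W \<and> inj_on \<pi> S \<and> \<pi> ` S = \<pi> ` T0}"
  define a where "a = (\<lambda>(S, y). ksgn f y S * g (insert y S))"
  have fin\<A>: "finite \<A>" using finW by (auto simp: \<A>_def intro: finite_subset[OF _ finite_Pow_iff[THEN iffD2]])
  define Q where "Q = Sigma \<A> (\<lambda>S. W - S)"
  have finQ: "finite Q" unfolding Q_def using fin\<A> finW by auto
  \<comment> \<open>In \<open>Q1\<close> the added vertex comes from a new block, in
    \<open>Q2\<close> it doubles a block already met by the face.\<close>
  define Q1 where "Q1 = {(S, y) \<in> Q. \<pi> y \<notin> \<pi> ` T0}"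
  define Q2 where "Q2 = {(S, y) \<in> Q. \<pi> y \<in> \<pi> ` T0}"
  have finQ12: "finite Q1" "finite Q2"
    using finQ by (auto simp: Q1_def Q2_def intro: finite_subset[OF _ finQ])
  have Q12: "Q = Q1 \<union> Q2" "Q1 \<inter> Q2 = {}" by (auto simp: Q1_def Q2_def)
  have "0 = (\<Sum>S\<in>\<A>. \<Sum>y\<in>W - S. a (S, y))" using cyc by (simp add: \<A>_def a_def)
  also have "\<dots> = sum a Q" unfolding Q_def using fin\<A> finW by (subst sum.Sigma) auto
  also have "\<dots> = sum a Q1 + sum a Q2"
    unfolding Q12(1) by (rule sum.union_disjoint[OF finQ12 Q12(2)])
  also have "sum a Q2 = 0"
  proof -
    define r where "r = (\<lambda>(S, y). THE x. x \<in> S \<and> \<pi> x = \<pi> y)"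
    have r: "r (S, y) \<in> S \<and> \<pi> (r (S, y)) = \<pi> y" if "(S, y) \<in> Q2" for S y
    proof -
      have "inj_on \<pi> S" "\<pi> y \<in> \<pi> ` S" using that by (auto simp: Q2_def Q_def \<A>_def)
      then have "\<exists>!x. x \<in> S \<and> \<pi> x = \<pi> y" by (metis (no_types, lifting) imageE inj_onD)
      then show ?thesis unfolding r_def prod.case by (rule theI')
    qed
    have r_eq: "r (S, y) = x" if "(S, y) \<in> Q2" "x \<in> S" "\<pi> x = \<pi> y" for S x y
    proof (rule inj_onD)
      show "inj_on \<pi> S" using that(1) by (auto simp: Q2_def Q_def \<A>_def)
    qed (use r[OF that(1)] that in auto)
    \<comment> \<open>Exchanges the added vertex y with the vertex of S in the same block. The union
      \<open>insert y S\<close> is unchanged, so only the sign can change.\<close>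
    define \<sigma> where "\<sigma> = (\<lambda>(S, y). (insert y (S - {r (S, y)}), r (S, y)))"
    have key: "\<sigma> (S, y) \<in> Q2 \<and> \<sigma> (\<sigma> (S, y)) = (S, y) \<and> a (\<sigma> (S, y)) = - a (S, y) \<and>
        (f (snd (\<sigma> (S, y))) < f (r (\<sigma> (S, y))) \<longleftrightarrow> \<not> f y < f (r (S, y)))"
      if Sy: "(S, y) \<in> Q2" for S y
    proof -
      define z where "z = r (S, y)"
      define U where "U = S - {z}"
      have z: "z \<in> S" "\<pi> z = \<pi> y" using r[OF Sy] by (auto simp: z_def)
      have S: "S \<subseteq> W" "inj_on \<pi> S" "\<pi> ` S = \<pi> ` T0" "y \<in> W" "y \<notin> S" "\<pi> y \<in> \<pi> ` T0"
        using Sy by (auto simp: Q2_def Q_def \<A>_def)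
      have SU: "S = insert z U" "z \<notin> U" "y \<notin> U" "y \<noteq> z" "finite U"
        using z S finW by (auto simp: U_def intro: finite_subset)
      have \<pi>U: "\<pi> x \<noteq> \<pi> y" if "x \<in> U" for x
        using that z inj_onD[OF S(2), of x z] by (auto simp: U_def)
      have \<sigma>: "\<sigma> (S, y) = (insert y U, z)" by (simp add: \<sigma>_def z_def U_def)
      have "\<pi> ` insert y U = \<pi> ` S" using SU z(2) by auto
      moreover have "inj_on \<pi> (insert y U)"
      proof -
        have "inj_on \<pi> U" using S(2) by (rule inj_on_subset) (auto simp: U_def)
        moreover have "\<pi> y \<notin> \<pi> ` U" using \<pi>U by (metis imageE)
        ultimately show ?thesis by auto
      qed
      ultimately have in2: "(insert y U, z) \<in> Q2"
        using S z SU by (auto simp: Q2_def Q_def \<A>_def)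
      have rz: "r (insert y U, z) = y" using r_eq[OF in2] z(2) by auto
      have \<sigma>\<sigma>: "\<sigma> (insert y U, z) = (S, y)"
        using SU by (auto simp: \<sigma>_def rz)
      \<comment> \<open>y and z share a block that \<open>U\<close> avoids, and \<open>f\<close>
        orders different blocks as \<pi> does; so no vertex of \<open>U\<close> lies between y and
        z.\<close>
      have "{x \<in> U. f x < f y} = {x \<in> U. f x < f z}"
      proof -
        have "f x < f y \<longleftrightarrow> f x < f z" if x: "x \<in> U" for x
        proof -
          have xW: "x \<in> W" using x S(1) by (auto simp: U_def)
          have "z \<in> W" using z(1) S(1) by auto
          from \<pi>U[OF x] consider "\<pi> x < \<pi> y" | "\<pi> y < \<pi> x" by linarith
          then show ?thesis
          proof cases
            case 1
            then have "f x < f y" "f x < f z" using ord xW S(4) \<open>z \<in> W\<close> z(2) by auto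
            then show ?thesis by simp
          next
            case 2
            then have "f y < f x" "f z < f x" using ord xW S(4) \<open>z \<in> W\<close> z(2) by auto
            then show ?thesis by simp
          qed
        qed
        then show ?thesis by blast
      qed
      then have sg: "(ksgn f y U :: 'a) = ksgn f z U" by (simp add: ksgn_def)
      have "f y \<noteq> f z"
      proof -
        have "y \<in> V" "z \<in> V" using S z W by auto
        then show ?thesis using SU(4) inj_f by (auto dest: inj_onD)
      qed
      then have fyz: "f y < f z \<or> f z < f y" by linarith
      have "(ksgn f z (insert y U) :: 'a) = - ksgn f y S"
        unfolding SU(1) using fyz SU sg by (auto simp: ksgn_insert)
      moreover have "insert z (insert y U) = insert y S" using SU(1) by auto
      ultimately have "a (insert y U, z) = - a (S, y)" by (simp add: a_def)
      then show ?thesis using in2 \<sigma>\<sigma> fyz unfolding \<sigma> by (auto simp: rz z_def[symmetric])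
    qed
    show ?thesis
    proof (rule sum_involution[of Q2 \<sigma> a "\<lambda>q. f (snd q) < f (r q)"])
      show "finite Q2" by (rule finQ12(2))
    qed (use key in auto)
  qed
  also have "sum a Q1 = a (T0, v)"
  proof -
    \<comment> \<open>Adding a vertex from a new block gives a transversal set again, where
      \<open>g0\<close> applies unless the set is \<open>T\<close>; and \<open>T\<close> arises only
      from \<open>T0\<close> and v.\<close>
    have "a q = 0" if q: "q \<in> Q1 - {(T0, v)}" for q
    proof -
      obtain S y where Sy: "q = (S, y)" by (cases q)
      have S: "S \<subseteq> W" "inj_on \<pi> S" "\<pi> ` S = \<pi> ` T0" "y \<in> W" "y \<notin> S" "\<pi> y \<notin> \<pi> ` T0"
        using q by (auto simp: Sy Q1_def Q_def \<A>_def)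
      have "insert y S \<noteq> T"
      proof
        assume *: "insert y S = T"
        have "y \<notin> T0" using S(6) by blast
        then have "y = v" using * T0(1) by blast
        then have "S = T0" using * S(5) T0(1,2) insert_ident[of y S T0] by simp
        with \<open>y = v\<close> q show False by (simp add: Sy)
      qed
      moreover have "inj_on \<pi> (insert y S)" using S by auto
      ultimately have "g (insert y S) = 0" using S by (intro g0) auto
      then show ?thesis by (simp add: Sy a_def)
    qed
    moreover have "(T0, v) \<in> Q1"
      using T0 T(3) by (auto simp: Q1_def Q_def \<A>_def dest: inj_on_subset)
    ultimately have "sum a {(T0, v)} = sum a Q1"
      using finQ12(1) by (intro sum.mono_neutral_left) auto
    then show ?thesis by simp
  qed
  finally have "ksgn f v T0 * g T = 0" by (simp add: a_def T0(1))
  then have "ksgn f v T0 * (ksgn f v T0 * g T) = 0" by simp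
  then show ?thesis by simp
qed

text \<open>The cycle is the boundary of a single term \<theta> at e_T that is outside the ideal. If
  a chain \<eta> of the ideal had the same boundary, \<theta> - \<eta> would be a cycle with a
  nonzero coefficient at just one transversal set, against \<open>cycle_transversal\<close>.\<close>

lemma not_kvanish_sqideal:
  fixes \<pi> :: "'v \<Rightarrow> nat"
  assumes U: "upset V U" and W: "W \<subseteq> V"
    and ord: "\<And>x y. x \<in> W \<Longrightarrow> y \<in> W \<Longrightarrow> \<pi> x < \<pi> y \<Longrightarrow> f x < f y"
    and T: "T \<subseteq> W" "card T = Suc p" "inj_on \<pi> T"
    and in_U: "\<And>S. S \<subseteq> W \<Longrightarrow> card S = p \<Longrightarrow> W - S \<in> U"
    and not_in_U: "\<And>S. S \<subseteq> W \<Longrightarrow> card S = Suc p \<Longrightarrow> inj_on \<pi> S \<Longrightarrow> W - S \<notin> U"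
  shows "\<not> kvanish (\<lambda>_. 0) (coord0 ` (sqideal V U :: ('v, 'k::field) mpoly set)) p (card W)"
proof
  let ?Z = "coord0 ` (sqideal V U :: ('v, 'k) mpoly set)"
  assume kv: "kvanish (\<lambda>_. 0) ?Z p (card W)"
  have finW: "finite W" using W finite_V by (rule finite_subset)
  have finS: "finite S" if "S \<subseteq> W" for S using that finW by (rule finite_subset)
  have Z: "submod V ?Z" using graded_submod_sqideal[OF U] unfolding graded_submod_def by blast
  \<comment> \<open>The complementary monomial gives the term the multidegree
    \<open>sqexp W\<close>. It is outside the ideal by \<open>not_in_U\<close>, while its boundary
    is inside by \<open>in_U\<close>, as the facets of \<open>T\<close> have \<open>p\<close>
    vertices.\<close>
  define \<theta> where "\<theta> S = (if S = T then monom (sqexp (W - T)) 1 else (0 :: ('v, 'k) mpoly))" for S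
  define w where "w = kd (\<lambda>S. coord0 (\<theta> S))"
  have "kchain (\<lambda>_. 0) (free_module V 1) (Suc p) (card W) (\<lambda>S. coord0 (\<theta> S))"
    unfolding kchain_def
  proof (intro allI conjI)
    fix S
    show "coord0 (\<theta> S) \<in> free_module V 1"
      using W finW by (auto simp: free_module_def coord0_def \<theta>_def polys_def supp_sqexp)
    have "card (W - T) + card T = card W"
      using T(1) finW by (metis card_Diff_subset card_mono finS le_add_diff_inverse2)
    then show "homog (\<lambda>l. 0 + card S) (card W) (coord0 (\<theta> S))"
      using finW by (auto simp: homog_def coord0_def \<theta>_def exp_degree_sqexp)
    show "coord0 (\<theta> S) \<noteq> 0 \<longrightarrow> S \<subseteq> V \<and> card S = Suc p"
      using T W by (auto simp: coord0_def \<theta>_def fun_eq_iff)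
  qed
  then have wf: "kchain (\<lambda>_. 0) (free_module V 1) p (card W) w" and cyc: "\<And>S. kd w S = 0"
    unfolding w_def using kchain_kd[OF submod_free] kd_kd by blast+
  have "w S \<in> ?Z" for S
  proof -
    have "(\<lambda>l. (ksgn f x S * var x) * coord0 (\<theta> (insert x S)) l) \<in> ?Z" if x: "x \<in> V - S" for x
    proof -
      have "ksgn f x S * (var x * \<theta> (insert x S)) \<in> sqideal V U"
      proof (cases "insert x S = T")
        case True
        have S: "S \<subseteq> W" "x \<in> W" using True T by auto
        have "card S = p" using True T(2) x finS[OF S(1)] by auto
        have "W - S = insert x (W - T)" "x \<notin> W - T" using True S x by auto
        then have "var x * \<theta> (insert x S) = monom (sqexp (W - S)) 1"
          using True finW by (simp add: \<theta>_def var_def mult_single sqexp_insert)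
        moreover have "monom (sqexp (W - S)) 1 \<in> sqideal V U"
          using in_U[OF S(1) \<open>card S = p\<close>] finW W by (intro monom_in_sqideal) auto
        ultimately show ?thesis using sqideal_mult[OF U polys_ksgn] by simp
      qed (simp add: \<theta>_def sqideal_0)
      moreover have "(\<lambda>l. (ksgn f x S * var x) * coord0 (\<theta> (insert x S)) l)
          = coord0 (ksgn f x S * (var x * \<theta> (insert x S)))"
        by (simp add: coord0_def fun_eq_iff mult.assoc)
      ultimately show ?thesis by simp
    qed
    then have "(\<lambda>l. \<Sum>x\<in>V - S. (ksgn f x S * var x) * coord0 (\<theta> (insert x S)) l) \<in> ?Z"
      by (rule submod_sum[OF Z])
    then show ?thesis by (simp add: w_def kd_def kd1_def mult.assoc)
  qed
  then have "kchain (\<lambda>_. 0) ?Z p (card W) w" using wf unfolding kchain_def by blast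
  then obtain \<eta> where \<eta>: "kchain (\<lambda>_. 0) ?Z (Suc p) (card W) \<eta>" "\<And>S. kd \<eta> S = w S"
    using kv cyc unfolding kvanish_def by blast
  \<comment> \<open>By \<open>not_in_U\<close> the chain \<eta> lacks the complementary monomial at
    every transversal set, so there the coefficient of \<delta> is that of \<theta>: 1 at
    \<open>T\<close> and 0 elsewhere.\<close>
  define \<delta> where "\<delta> S = \<theta> S - \<eta> S 0" for S
  have kd\<delta>: "kd1 \<delta> S = 0" for S
  proof -
    have "kd \<eta> S 0 = kd (\<lambda>S. coord0 (\<theta> S)) S 0" by (simp add: \<eta>(2) w_def)
    then show ?thesis
      by (simp add: \<delta>_def kd_def kd1_def coord0_def right_diff_distrib sum_subtractf)
  qed
  have \<eta>0: "coef (\<eta> S 0) (sqexp (W - S)) = 0" if S: "S \<subseteq> W" "inj_on \<pi> S" for S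
  proof (cases "card S = Suc p")
    case True
    have "\<eta> S \<in> ?Z" using \<eta>(1) unfolding kchain_def by blast
    then have "\<eta> S 0 \<in> sqideal V U" by (auto simp: coord0_def)
    then have "sqexp (W - S) \<notin> supp (\<eta> S 0)"
      using not_in_U[OF S(1) True S(2)] finW supp_sqexp[of "W - S"] by (auto simp: sqideal_def)
    then show ?thesis by (simp add: in_keys_iff)
  next
    case False
    then have "\<eta> S = 0" using \<eta>(1) unfolding kchain_def by blast
    then show ?thesis by simp
  qed
  have "coef (\<delta> T) (sqexp (W - T)) = 0"
  proof (rule cycle_transversal[of W \<pi> "\<lambda>S. coef (\<delta> S) (sqexp (W - S))" T])
    show "T \<noteq> {}" using T(2) by auto
    show "coef (\<delta> S) (sqexp (W - S)) = 0" if "S \<subseteq> W" "inj_on \<pi> S" "S \<noteq> T" for S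
      using \<eta>0 that by (simp add: \<delta>_def \<theta>_def lookup_minus)
    fix S assume S: "S \<subseteq> W"
    have "0 = coef (kd1 \<delta> S) (sqexp (W - S))" by (simp add: kd\<delta>)
    also have "\<dots> = (\<Sum>x\<in>W - S. ksgn f x S * coef (\<delta> (insert x S)) (sqexp (W - insert x S)))"
      unfolding coef_kd1
    proof (rule sum.mono_neutral_cong_right)
      fix x assume x: "x \<in> W - S"
      then have "sqexp (W - S) = sqexp (W - insert x S) + monom x 1"
        using finW sqexp_remove[of "W - S" x] by (simp add: add.commute Diff_insert2[of W x S, symmetric] insert_commute flip: Diff_insert)
      then have "sqexp (W - S) - monom x 1 = sqexp (W - insert x S)" by simp
      then show "ksgn f x S * (if 1 \<le> coef (sqexp (W - S)) x
          then coef (\<delta> (insert x S)) (sqexp (W - S) - monom x 1) else 0)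
        = ksgn f x S * coef (\<delta> (insert x S)) (sqexp (W - insert x S))"
        using x finW by (simp add: coef_sqexp)
    qed (use W finW finite_V in \<open>auto simp: coef_sqexp\<close>)
    finally show "(\<Sum>y\<in>W - S. ksgn f y S * coef (\<delta> (insert y S)) (sqexp (W - insert y S))) = 0" by simp
  qed (use W ord T in auto)
  moreover have "coef (\<delta> T) (sqexp (W - T)) = 1"
    using \<eta>0[OF T(1,3)] by (simp add: \<delta>_def \<theta>_def lookup_minus)
  ultimately show False by simp
qed

text \<open>\<open>Max\<close> is meaningful only on a finite set: nonzero Betti numbers have i at
  most \<open>card V\<close>, as there are no larger faces, and j at most \<open>card V\<close> by
  \<open>kvanish_sqideal\<close>.\<close>

lemma reg_sqideal_ge:
  fixes J :: "('v, 'k::field) mpoly set"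
  assumes U: "upset V U" and J: "J = sqideal V U" and nz: "J \<noteq> {0}"
    and nv: "\<not> kvanish (\<lambda>_. 0) (coord0 ` J) i j"
  shows "int j - int i \<le> reg V J"
proof -
  have iff: "betti V J i j \<noteq> 0 \<longleftrightarrow> \<not> kvanish (\<lambda>_. 0) (coord0 ` J) i j" for i j
    unfolding J
    by (rule betti_nonzero_iff[OF graded_submod_sqideal[OF U] kvanish_sqideal])
  let ?B = "{int j - int i | i j. betti V J i j \<noteq> 0}"
  have "?B \<subseteq> (\<lambda>(i, j). int j - int i) ` ({..card V} \<times> {..card V})"
  proof
    fix b assume "b \<in> ?B"
    then obtain i j where "b = int j - int i" "betti V J i j \<noteq> 0" by blast
    then have b: "b = int j - int i" "\<not> kvanish (\<lambda>_. 0) (coord0 ` J) i j"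
      using iff by blast+
    have "0 \<in> coord0 ` J"
      using graded_submod_sqideal[OF U] unfolding J graded_submod_def by (blast intro: submod_0)
    then have "i \<le> card V" using kvanish_above_card b(2) not_le by blast
    moreover have "j \<le> card V" using kvanish_sqideal b(2) not_le unfolding J by blast
    ultimately show "b \<in> (\<lambda>(i, j). int j - int i) ` ({..card V} \<times> {..card V})"
      using b(1) by (intro image_eqI[of _ _ "(i, j)"]) auto
  qed
  then have "finite ?B" by (rule finite_subset) auto
  moreover have "int j - int i \<in> ?B" using iff nv by blast
  ultimately show ?thesis using nz by (simp add: reg_def)
qed

end

section \<open>Admissible matchings\<close>

lemma card_Union_uniform:
  assumes "finite M" "pairwise disjnt M" "\<And>e. e \<in> M \<Longrightarrow> finite e \<and> card e = d"
  shows "card (\<Union>M) = d * card M"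
  using assms by (simp add: card_Union_disjoint mult.commute)

text \<open>The edges are disjoint, so each vertex of \<open>S\<close> meets at most one of them;
  choosing a common vertex for every edge hit is injective.\<close>

lemma matching_avoiding:
  assumes M: "finite M" "pairwise disjnt M" and S: "finite S"
  shows "card M \<le> card {e \<in> M. e \<inter> S = {}} + card S"
proof -
  let ?M = "{e \<in> M. e \<inter> S \<noteq> {}}"
  have "\<forall>e\<in>?M. \<exists>x. x \<in> e \<and> x \<in> S" by blast
  then obtain h where h: "\<And>e. e \<in> ?M \<Longrightarrow> h e \<in> e \<and> h e \<in> S" by metis
  have "inj_on h ?M"
  proof (rule inj_onI)
    fix e e' assume "e \<in> ?M" "e' \<in> ?M" "h e = h e'"
    then have "h e \<in> e \<inter> e'" using h by (metis IntI)
    then show "e = e'"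
      using M(2) \<open>e \<in> ?M\<close> \<open>e' \<in> ?M\<close> unfolding pairwise_def disjnt_def by blast
  qed
  then have "card ?M \<le> card S" by (rule card_inj_on_le) (use h S in auto)
  moreover have "card M = card {e \<in> M. e \<inter> S = {}} + card ?M"
    using M(1) by (subst card_Un_disjoint[symmetric]) (auto intro: arg_cong[of _ _ card])
  ultimately show ?thesis by simp
qed

text \<open>By counting vertices, a block \<open>\<Union>N\<close> contains at most \<open>card N\<close> edges of \<open>M'\<close>, and fewer if they
  miss a vertex of it.\<close>

lemma matching_missing_transversal:
  assumes P: "partition_on M P" and M: "finite M" "pairwise disjnt M"
    and unif: "\<And>e. e \<in> M \<union> M' \<Longrightarrow> finite e \<and> card e = d" and d: "d > 0"
    and M': "finite M'" "pairwise disjnt M'" "\<Union>M' \<inter> S = {}" "\<And>e. e \<in> M' \<Longrightarrow> \<exists>N\<in>P. e \<subseteq> \<Union>N"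
    and S: "\<And>x. x \<in> S \<Longrightarrow> b x \<in> P \<and> x \<in> \<Union>(b x)" "inj_on b S"
  shows "card M' + card S \<le> card M"
proof -
  have finP: "finite P" using P M(1) by (rule finite_elements[rotated])
  have sub: "N \<subseteq> M" "finite N" if "N \<in> P" for N
    using P that M(1) by (auto simp: partition_on_def intro: finite_subset)
  define M'' where "M'' N = {e \<in> M'. e \<subseteq> \<Union>N}" for N
  have block: "card (M'' N) + card {x \<in> S. b x = N} \<le> card N" if N: "N \<in> P" for N
  proof -
    have fin: "finite (M'' N)" using M'(1) by (simp add: M''_def)
    have cardN: "card (\<Union>N) = d * card N"
      using sub[OF N] M(2) unif by (intro card_Union_uniform) (auto intro: pairwise_subset)
    have cardM'': "card (\<Union>(M'' N)) = d * card (M'' N)"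
      using M'(2) unif fin by (intro card_Union_uniform) (auto simp: M''_def intro: pairwise_subset)
    have finN: "finite (\<Union>N)" using sub[OF N] unif by auto
    show ?thesis
    proof (cases "\<exists>x\<in>S. b x = N")
      case False
      then have "{x \<in> S. b x = N} = {}" by blast
      moreover have "d * card (M'' N) \<le> d * card N"
        unfolding cardN[symmetric] cardM''[symmetric]
        using finN by (intro card_mono) (auto simp: M''_def)
      ultimately show ?thesis using d by (simp del: Collect_empty_eq)
    next
      case True
      then obtain x where x: "x \<in> S" "b x = N" by blast
      then have "{x \<in> S. b x = N} = {x}" using S(2) by (auto dest: inj_onD)
      moreover have "d * card (M'' N) < d * card N"
        unfolding cardN[symmetric] cardM''[symmetric]
      proof (rule psubset_card_mono[OF finN])
        have "x \<in> \<Union>N" "x \<notin> \<Union>(M'' N)" using S(1) x M'(3) by (auto simp: M''_def)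
        then show "\<Union>(M'' N) \<subset> \<Union>N" by (auto simp: M''_def)
      qed
      ultimately show ?thesis using d by simp
    qed
  qed
  have finS: "finite S"
  proof (rule finite_imageD[OF _ S(2)])
    show "finite (b ` S)" using S(1) finP by (auto intro: finite_subset)
  qed
  have "M' = (\<Union>N\<in>P. M'' N)" using M'(4) by (auto simp: M''_def)
  then have "card M' \<le> (\<Sum>N\<in>P. card (M'' N))"
    using card_UN_le[OF finP, of M''] by simp
  moreover have "card S = (\<Sum>N\<in>P. card {x \<in> S. b x = N})"
  proof -
    have "b ` S \<subseteq> P" using S(1) by blast
    from sum.group[OF finS finP this, of "\<lambda>_. 1::nat"] show ?thesis by simp
  qed
  moreover have "(\<Sum>N\<in>P. card (M'' N)) + (\<Sum>N\<in>P. card {x \<in> S. b x = N}) \<le> (\<Sum>N\<in>P. card N)"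
    unfolding sum.distrib[symmetric] by (rule sum_mono[OF block])
  moreover have "(\<Sum>N\<in>P. card N) = card M"
    using card_Union_disjoint[of P] sub partition_onD1[OF P] partition_onD2[OF P]
    by (simp add: disjoint_def pairwise_def disjnt_def)
  ultimately show ?thesis by linarith
qed

lemma exists_block_order:
  assumes "finite V"
  shows "\<exists>f :: 'v \<Rightarrow> nat. inj_on f V \<and> (\<forall>x\<in>V. \<forall>y. \<pi> x < (\<pi> y :: nat) \<longrightarrow> f x < f y)"
proof -
  obtain e where e: "bij_betw e V {0..<card V}" using ex_bij_betw_finite_nat[OF assms] by blast
  then have lt: "e x < card V" if "x \<in> V" for x using that by (auto simp: bij_betw_def)
  \<comment> \<open>Lexicographic order encoded in one number: block first, then the enumeration
    \<open>e\<close>, whose values stay below \<open>card V\<close>.\<close>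
  define f where "f x = \<pi> x * card V + e x" for x
  have less: "f x < f y" if "x \<in> V" "\<pi> x < \<pi> y" for x y
  proof -
    have "f x < Suc (\<pi> x) * card V" using lt[OF that(1)] by (simp add: f_def)
    also have "\<dots> \<le> \<pi> y * card V" using that(2) by (intro mult_right_mono) auto
    finally show ?thesis by (simp add: f_def)
  qed
  have "inj_on f V"
  proof (rule inj_onI)
    fix x y assume xy: "x \<in> V" "y \<in> V" "f x = f y"
    then have "\<pi> x = \<pi> y" using less by (metis less_irrefl linorder_less_linear)
    then have "e x = e y" using xy(3) by (simp add: f_def)
    then show "x = y" using e xy by (auto simp: bij_betw_def dest: inj_onD)
  qed
  then show ?thesis using less by (intro exI[of _ f]) blast
qed

lemma reg_sqfree_power_ge:
  assumes H: "uniform_hypergraph d H" and M: "admissible_matching H k M" and k: "1 \<le> k" "k \<le> card M"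
  shows "(int d - 1) * int (card M) + int k
    \<le> reg (verts H) (sqfree_power (verts H) (edge_ideal H :: ('v, 'k::field) mpoly set) k)"
proof -
  define V where "V = verts H"
  define U where "U = matched_sets H k"
  define J where "J = (sqideal V U :: ('v, 'k) mpoly set)"
  define W where "W = \<Union>M"
  have hyp: "hypergraph H" using H by (simp add: uniform_hypergraph_def)
  have V: "finite V" using hyp by (simp add: hypergraph_def V_def)
  have edge: "finite e \<and> card e = d \<and> e \<noteq> {} \<and> e \<subseteq> V" if "e \<in> edges H" for e
    using H that V by (auto simp: uniform_hypergraph_def hypergraph_def V_def intro: finite_subset)
  have ME: "M \<subseteq> edges H" "pairwise disjnt M" using M by (auto simp: admissible_matching_def matching_def)
  have "edges H \<subseteq> Pow V" using edge by blast
  then have finE: "finite (edges H)" using V by (meson finite_Pow_iff finite_subset)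
  have finM: "finite M" using ME(1) finE by (rule finite_subset)
  have WV: "W \<subseteq> V" unfolding W_def using ME(1) edge by blast
  have finW: "finite W" using WV V by (rule finite_subset)
  have d: "d > 0"
  proof -
    obtain e where "e \<in> M" using k by fastforce
    then show ?thesis using ME(1) edge by (metis card_gt_0_iff subsetD)
  qed
  obtain P where P: "partition_on M P" "\<And>e. e \<in> edges H \<Longrightarrow> e \<subseteq> W \<Longrightarrow> \<exists>N\<in>P. e \<subseteq> \<Union>N"
    "int (card M) \<le> int (card P) + int k - 1"
    using M unfolding admissible_matching_def induced_def edges_def W_def by auto
  have finP: "finite P" using P(1) finM by (rule finite_elements[rotated])
  have cardW: "card W = d * card M"
    unfolding W_def using finM ME edge by (intro card_Union_uniform) auto
  \<comment> \<open>Removing \<open>p\<close> vertices destroys at most \<open>p\<close> edges of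
    \<open>M\<close>, which leaves a matching of size \<open>k\<close>; hence every
    \<open>p\<close>-element subset of \<open>W\<close> is a face.\<close>
  define p where "p = card M - k"
  have p: "Suc p \<le> card P" using P(3) k by (simp add: p_def)

  have "\<forall>x\<in>W. \<exists>N. N \<in> P \<and> x \<in> \<Union>N" using P(1) by (auto simp: W_def partition_on_def)
  from bchoice[OF this] obtain b where b: "\<And>x. x \<in> W \<Longrightarrow> b x \<in> P \<and> x \<in> \<Union>(b x)" by blast
  \<comment> \<open>Blocks are disjoint as sets of edges; because the edges of a matching are
    disjoint, they are disjoint as sets of vertices too.\<close>
  have b_eq: "b x = N" if x: "N \<in> P" "x \<in> \<Union>N" for x N
  proof -
    obtain e where e: "e \<in> N" "x \<in> e" using x by blast
    have NM: "N \<subseteq> M" using P(1) x by (auto simp: partition_on_def)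
    then have "x \<in> W" using e by (auto simp: W_def)
    then obtain e' where e': "e' \<in> b x" "x \<in> e'" "b x \<in> P" using b by blast
    have "e' \<in> M" using P(1) e' by (auto simp: partition_on_def)
    then have "e = e'" using ME(2) e e' NM unfolding pairwise_def disjnt_def by blast
    then show ?thesis using P(1) e e' x unfolding partition_on_def disjoint_def by blast
  qed
  obtain idx where idx: "bij_betw idx P {0..<card P}" using ex_bij_betw_finite_nat[OF finP] by blast
  define \<pi> where "\<pi> x = idx (b x)" for x
  have inj_b: "inj_on b S" if "inj_on \<pi> S" for S
    using that by (auto simp: \<pi>_def inj_on_def)
  obtain f :: "'v \<Rightarrow> nat" where f: "inj_on f V" "\<And>x y. x \<in> V \<Longrightarrow> \<pi> x < \<pi> y \<Longrightarrow> f x < f y"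
    using exists_block_order[OF V, of \<pi>] by blast
  interpret koszul V f by unfold_locales (fact V f(1))+

  \<comment> \<open>One vertex \<open>r N\<close> from each of \<open>p + 1\<close> blocks forms the
    transversal \<open>T\<close>.\<close>
  obtain P' where P': "P' \<subseteq> P" "card P' = Suc p" using p obtain_subset_with_card_n by metis
  have "\<forall>N\<in>P. \<exists>x. x \<in> \<Union>N"
  proof
    fix N assume N: "N \<in> P"
    then have "N \<noteq> {}" using partition_onD3[OF P(1)] by blast
    then obtain e where "e \<in> N" by blast
    moreover have "e \<in> edges H" using \<open>e \<in> N\<close> N P(1) ME(1) by (auto simp: partition_on_def)
    ultimately show "\<exists>x. x \<in> \<Union>N" using edge by blast
  qed
  then obtain r where r: "\<And>N. N \<in> P \<Longrightarrow> r N \<in> \<Union>N" by metis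
  have br: "b (r N) = N" if "N \<in> P" for N using b_eq[OF that r[OF that]] .
  define T where "T = r ` P'"
  have "T \<subseteq> W" unfolding T_def W_def using r P' P(1) by (auto simp: partition_on_def) (metis UnionE UnionI subsetD)
  moreover have "inj_on r P'" using br P' by (metis inj_on_def subsetD)
  then have "card T = Suc p" unfolding T_def using P' by (simp add: card_image)
  moreover have "inj_on \<pi> T"
  proof (rule inj_onI)
    fix x y assume "x \<in> T" "y \<in> T" "\<pi> x = \<pi> y"
    then obtain N N' where N: "x = r N" "y = r N'" "N \<in> P" "N' \<in> P" using P' by (auto simp: T_def)
    then have "idx N = idx N'" using \<open>\<pi> x = \<pi> y\<close> by (simp add: \<pi>_def br)
    then show "x = y" using idx N by (auto simp: bij_betw_def dest: inj_onD)
  qed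
  moreover have "W - S \<in> U" if S: "S \<subseteq> W" "card S = p" for S
  proof -
    have finS: "finite S" using S(1) finW by (rule finite_subset)
    have "k \<le> card {e \<in> M. e \<inter> S = {}}"
      using matching_avoiding[OF finM ME(2) finS] k S(2) by (simp add: p_def)
    then obtain N where N: "N \<subseteq> {e \<in> M. e \<inter> S = {}}" "card N = k"
      using obtain_subset_with_card_n[of k "{e \<in> M. e \<inter> S = {}}"] by blast
    have "N \<subseteq> M" using N(1) by blast
    then have "matching H N" using ME unfolding matching_def by (auto intro: pairwise_subset)
    moreover have "\<Union>N \<subseteq> W - S" using N(1) unfolding W_def by blast
    ultimately show ?thesis using N(2) WV unfolding U_def matched_sets_def V_def by blast
  qed
  moreover have "W - S \<notin> U" if S: "S \<subseteq> W" "card S = Suc p" "inj_on \<pi> S" for S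
  proof
    assume "W - S \<in> U"
    then obtain N where N: "N \<subseteq> edges H" "pairwise disjnt N" "card N = k" "\<Union>N \<subseteq> W - S"
      unfolding U_def matched_sets_def matching_def by blast
    have "card N + card S \<le> card M"
    proof (rule matching_missing_transversal[OF P(1) finM ME(2) _ d])
      show "finite e \<and> card e = d" if "e \<in> M \<union> N" for e using that ME(1) N(1) edge by blast
      show "finite N" using N(1) finE by (rule finite_subset)
      \<comment> \<open>Condition (1) of admissibility: edges of \<open>N\<close> lie inside
        \<open>W\<close>, hence none of them straddles two blocks.\<close>
      show "\<exists>N'\<in>P. e \<subseteq> \<Union>N'" if "e \<in> N" for e using that N by (intro P(2)) auto
      show "b x \<in> P \<and> x \<in> \<Union>(b x)" if "x \<in> S" for x using that S(1) b by blast
    qed (use N inj_b[OF S(3)] in auto)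
    then show False using N(3) S(2) k by (simp add: p_def)
  qed
  ultimately have "\<not> kvanish (\<lambda>_. 0) (coord0 ` J) p (card W)"
    unfolding J_def using f(2) WV upset_matched_sets[of H k]
    by (intro not_kvanish_sqideal[where \<pi> = \<pi> and T = T]) (auto simp: V_def U_def)
  moreover have "J \<noteq> {0}"
  proof -
    obtain N where N: "N \<subseteq> M" "card N = k" using obtain_subset_with_card_n[OF k(2)] by metis
    have "matching H N" using N(1) ME unfolding matching_def by (auto intro: pairwise_subset)
    then have "W \<in> U" using N WV unfolding U_def matched_sets_def V_def W_def by blast
    then have "monom (sqexp W) 1 \<in> J" unfolding J_def by (intro monom_in_sqideal finW WV)
    moreover have "monom (sqexp W) (1 :: 'k) \<noteq> 0" by (metis lookup_single_eq lookup_zero zero_neq_one)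
    ultimately show ?thesis by blast
  qed
  ultimately have "int (card W) - int p \<le> reg V J"
    using upset_matched_sets[of H k]
    by (intro reg_sqideal_ge[where U = U]) (auto simp: J_def U_def V_def matched_sets_def)
  moreover have "int (card W) - int p = (int d - 1) * int (card M) + int k"
    using k by (simp add: cardW p_def of_nat_diff algebra_simps)
  moreover have "J = sqfree_power (verts H) (edge_ideal H) k"
    unfolding J_def U_def V_def by (rule sqfree_power_edge_ideal[OF hyp, symmetric])
  ultimately show ?thesis by (simp add: V_def)
qed

text \<open>Any matching of size \<open>k\<close> is admissible with a single block, as k <= 1 + k -
  1. So the maximum defining \<open>aim\<close> is over a nonempty set and is at least
  \<open>k\<close>, which makes \<open>card M - k\<close> a true difference.\<close>

lemma aim_attained:
  assumes H: "hypergraph H" and k: "1 \<le> k" "k \<le> matching_number H"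
  shows "\<exists>M. admissible_matching H k M \<and> card M = aim H k \<and> k \<le> card M"
proof -
  have "edges H \<subseteq> Pow (verts H)" "finite (verts H)" using H by (auto simp: hypergraph_def)
  then have finE: "finite (edges H)" by (meson finite_Pow_iff finite_subset)
  have bound: "finite {card M | M. Q M}" if "\<And>M. Q M \<Longrightarrow> matching H M" for Q
  proof (rule finite_subset)
    show "{card M | M. Q M} \<subseteq> {..card (edges H)}"
      using that finE by (auto simp: matching_def intro: card_mono)
  qed simp
  have "matching_number H \<in> {card M | M. matching H M}"
    unfolding matching_number_def
    by (intro Max_in bound) (auto simp: matching_def intro!: exI[of _ "{}"])
  then obtain M0 where M0: "matching H M0" "k \<le> card M0" using k(2) by auto
  obtain N where N: "N \<subseteq> M0" "card N = k" using obtain_subset_with_card_n[OF M0(2)] by metis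
  have "N \<noteq> {}" using N k by auto
  have "matching H N" using N M0(1) unfolding matching_def by (auto intro: pairwise_subset)
  moreover have "partition_on N {N}" using \<open>N \<noteq> {}\<close> by (simp add: partition_on_space)
  ultimately have adm: "admissible_matching H k N"
    unfolding admissible_matching_def using N(2) by (auto intro!: exI[of _ "{N}"])
  have fin: "finite {card M | M. admissible_matching H k M}"
    by (rule bound) (simp add: admissible_matching_def)
  have "aim H k \<in> {card M | M. admissible_matching H k M}"
    unfolding aim_def using adm by (intro Max_in fin) auto
  moreover have "k \<le> aim H k"
    unfolding aim_def using adm N(2) by (intro Max_ge fin) auto
  ultimately show ?thesis by auto
qed

theorem theorem3p16:
  fixes H G :: "'v hgraph" and d k :: nat
  shows "(uniform_hypergraph d H \<and> 1 \<le> k \<and> k \<le> matching_number H \<longrightarrow>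
      reg (verts H) (sqfree_power (verts H) (edge_ideal H :: ('v, 'k::field) mpoly set) k)
        \<ge> (int d - 1) * int (aim H k) + int k) \<and>
    (simple_graph G \<and> 1 \<le> k \<and> k \<le> matching_number G \<longrightarrow>
      reg (verts G) (sqfree_power (verts G) (edge_ideal G :: ('v, 'k::field) mpoly set) k)
        \<ge> int (aim G k) + int k)"
proof -
  have bound: "(int d - 1) * int (aim H k) + int k
      \<le> reg (verts H) (sqfree_power (verts H) (edge_ideal H :: ('v, 'k) mpoly set) k)"
    if H: "uniform_hypergraph d H" and k: "1 \<le> k" "k \<le> matching_number H" for H :: "'v hgraph" and d
  proof -
    have "hypergraph H" using H by (simp add: uniform_hypergraph_def)
    then obtain M where "admissible_matching H k M" "card M = aim H k" "k \<le> card M"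
      using aim_attained[OF _ k] by blast
    then show ?thesis using reg_sqfree_power_ge[OF H _ k(1), of M] by simp
  qed
  show ?thesis
    using bound[of d H] bound[of 2 G] by (auto simp: simple_graph_def)
qed

end
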